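(* Let $d\in\mathbb{N}$, $\kappa\in(0,\infty)$, let $(\Omega,\mathcal{F},\mathbb{P})$ be a probability space, and let $X_{n,m}\colon\Omega\to\mathbb{R}^d$, $(n,m)\in\mathbb{Z}^2$, be non-degenerate i.i.d. random variables. Let $\mathfrak{l}\colon\mathbb{R}^d\times\mathbb{R}^d\to\mathbb{R}$ satisfy $\mathfrak{l}(\theta,x) = \kappa\|\theta-x\|^2$ for all $\theta,x\in\mathbb{R}^d$. Let $M,\mathfrak{M}\in\mathbb{N}$ and let $\Theta\colon\mathbb{N}_0\times\Omega\to\mathbb{R}^d$ and $\gamma\colon\mathbb{N}\times\Omega\to\mathbb{R}$ be stochastic processes such that for all $n\in\mathbb{N}$ $$\Theta_n = \Theta_{n-1} - \frac{\gamma_n}{M}\Big[\sum_{m=1}^M(\nabla_\theta\mathfrak{l})(\Theta_{n-1},X_{n,m})\Big].$$ Let $(\nu_n)_{n\in\mathbb{N}}\subseteq\mathbb{R}$ be strictly decreasing with $\limsup_{n\to\infty}\nu_n = 0$ and $\sum_{n=1}^\infty\nu_n=\infty$. Assume $\gamma_1=\nu_1<\kappa^{-1}$ and for all $n\in\mathbb{N}$ $$\gamma_{n+1} = \begin{cases} \gamma_n & \text{if } \sum_{m=1}^{\mathfrak{M}} \mathfrak{l}(\Theta_n, X_{n,-m}) \le \sum_{m=1}^{\mathfrak{M}} \mathfrak{l}(\Theta_{n-1}, X_{n,-m}),\\ \max\big((0,\gamma_n)\cap \{\nu_k\colon k\in\mathbb{N}\}\big) & \text{if } \sum_{m=1}^{\mathfrak{M}}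 \mathfrak{l}(\Theta_n, X_{n,-m}) > \sum_{m=1}^{\mathfrak{M}} \mathfrak{l}(\Theta_{n-1}, X_{n,-m}).\end{cases}$$ For every $t\in[0,\infty)$ let $N_t=\inf\{n\in\mathbb{N}_0\colon\sum_{k=1}^n\gamma_k\ge t\}$. Assume that $(X_{n,m})_{(n,m)\in\mathbb{Z}^2}$ and $\Theta_0$ are independent and that $\mathbb{E}\big[\|\Theta_0\|^2 + \sup_{n\in\mathbb{N}}\|X_{n,0}\|\big]<\infty$. Then $$\limsup_{t\to\infty}\mathbb{E}\big[\|\Theta_{N_t}-\mathbb{E}[X_{1,1}]\|^2\big]=0.$$
   Context: $\|\cdot\|$ is the Euclidean norm. For a Borel measure $\mu$ on $\mathbb{R}^d$, its support is $\operatorname{supp}(\mu)=\{x\in\mathbb{R}^d\colon \mu(A)>0 \text{ for every open } A\ni x\}$. For a random variable $X$ with values in $\mathbb{R}^d$, $\operatorname{supp}(X)=\operatorname{supp}(\mathbb{P}_X)$ where $\mathbb{P}_X$ is the law of $X$. A random variable $X$ is called non-degenerate if the interior of $\operatorname{supp}(X)$ is non-empty. *)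

theory Defs
  imports "HOL-Probability.Probability"
begin

definition measure_support :: "'a::topological_space measure \<Rightarrow> 'a set" where
  "measure_support \<mu> = {x. \<forall>A. open A \<longrightarrow> x \<in> A \<longrightarrow> emeasure \<mu> A > 0}"

definition non_degenerate :: "'w measure \<Rightarrow> ('w \<Rightarrow> 'a::topological_space) \<Rightarrow> bool" where
  "non_degenerate P X \<longleftrightarrow> interior (measure_support (distr P borel X)) \<noteq> {}"

end

theory Submission
  imports Defs "HOL-Real_Asymp.Real_Asymp"
begin

text \<open>
  The recursion is \<open>e\<^sub>n\<^sub>+\<^sub>1 = (1 - a\<^sub>n) e\<^sub>n + a\<^sub>n \<xi>\<^sub>n\<close> for the error \<open>e = \<Theta> - \<bbbE>[X]\<close>, with predictable
  rates \<open>a\<^sub>n = 2 \<kappa> \<gamma>\<^sub>n\<^sub>+\<^sub>1\<close> and centred noise \<open>\<xi>\<^sub>n\<close> independent of the past. Integrability of the supremum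
  of an i.i.d. sequence forces the noise to be essentially bounded, hence \<open>\<parallel>e\<^sub>n\<parallel>\<^sup>2\<close> is dominated by one integrable
  function, uniformly in \<open>n\<close>.

  The step sizes tend to 0 almost surely: while the step size stays constant, a long run of data near one
  support point \<open>x\<^sub>0\<close> drives \<open>\<Theta>\<close> to \<open>x\<^sub>0\<close>, and a final batch near another support point \<open>x\<^sub>1\<close>, validated by
  data near \<open>x\<^sub>0\<close>, raises the validation loss and so decreases the step size. By Borel-Cantelli such runs occur
  infinitely often.

  Once \<open>a\<^sub>n \<le> \<epsilon>\<close>, the weighted energy \<open>\<parallel>e\<^sub>n\<parallel>\<^sup>2 exp (a\<^sub>0 + \<dots> + a\<^sub>n\<^sub>-\<^sub>1)\<close> grows, up to a centred term, at most by
  \<open>2 \<epsilon> R\<^sup>2\<close> times the growth of the weight. Since the weight is essentially the deterministic \<open>exp T\<close> at the time where the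
  accumulated rates reach \<open>T\<close>, the expected energy there is \<open>O(\<epsilon>)\<close> as \<open>T \<rightarrow> \<infinity>\<close>, apart from the event that
  the rates are not yet below \<open>\<epsilon>\<close>, which domination makes negligible.
\<close>

section \<open>Averaging recursions along one path\<close>

text \<open>The ball of radius \<open>K = max (norm (e 0)) (2 * R / (2 - \<alpha>))\<close> is
  invariant. For \<open>a n \<le> 1\<close> the update is a convex combination of points of the
  ball. For larger rates \<open>e n\<close> is reflected with factor \<open>a n - 1\<close>, and
  \<open>2 * R \<le> (2 - \<alpha>) * K\<close> pays for the noise.\<close>

lemma averaging_bounded:
  fixes e \<xi> :: "nat \<Rightarrow> 'a::real_normed_vector" and a :: "nat \<Rightarrow> real"
  assumes rec: "\<And>n. e (Suc n) = (1 - a n) *\<^sub>R e n + a n *\<^sub>R \<xi> n"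
    and a: "\<And>n. 0 \<le> a n" "\<And>n. a n \<le> \<alpha>" "\<alpha> < 2"
    and \<xi>: "\<And>n. norm (\<xi> n) \<le> R"
  shows "norm (e n) \<le> max (norm (e 0)) (2 * R / (2 - \<alpha>))"
proof (induction n)
  case (Suc n)
  define K where "K = max (norm (e 0)) (2 * R / (2 - \<alpha>))"
  have "2 * R = (2 - \<alpha>) * (2 * R / (2 - \<alpha>))" using a(3) by simp
  also have "\<dots> \<le> (2 - \<alpha>) * K" using a(3) by (intro mult_left_mono) (auto simp: K_def)
  finally have 2: "2 * R \<le> (2 - \<alpha>) * K" .
  have K0: "0 \<le> K" unfolding K_def by (simp add: le_max_iff_disj)
  have R0: "0 \<le> R" using order_trans[OF norm_ge_zero \<xi>] .
  have R: "R \<le> K"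
  proof -
    have "(2 - \<alpha>) * K \<le> 2 * K" using a(1)[of 0] a(2)[of 0] K0 by (intro mult_right_mono) auto
    with 2 show ?thesis by simp
  qed
  have "norm (e (Suc n)) \<le> \<bar>1 - a n\<bar> * norm (e n) + a n * norm (\<xi> n)"
    unfolding rec using norm_triangle_ineq[of "(1 - a n) *\<^sub>R e n" "a n *\<^sub>R \<xi> n"] a(1)[of n] by simp
  also have "\<dots> \<le> \<bar>1 - a n\<bar> * K + a n * R"
    using Suc \<xi> a(1) by (intro add_mono mult_left_mono) (auto simp: K_def)
  also have "\<dots> \<le> K"
  proof (cases "a n \<le> 1")
    case True
    have "a n * R \<le> a n * K" using a(1) R by (intro mult_left_mono) auto
    with True show ?thesis by (simp add: algebra_simps)
  next
    case False
    have "a n * R \<le> 2 * R" using a(2)[of n] a(3) R0 by (intro mult_right_mono) auto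
    also have "\<dots> \<le> (2 - a n) * K"
      using 2 mult_right_mono[OF _ K0, of "2 - \<alpha>" "2 - a n"] a(2)[of n] by linarith
    finally show ?thesis using False by (simp add: algebra_simps)
  qed
  finally show ?case by (simp add: K_def)
qed simp

text \<open>Weighting the energy with \<open>exp (S n)\<close> cancels its decay, because
  \<open>(1 - a)\<^sup>2 * exp a \<le> 1\<close> on [0,1]. The squared noise costs at most
  \<open>\<epsilon> * a * R\<^sup>2\<close> per step, and since
  \<open>a * exp a \<le> 2 * (exp a - 1)\<close> these costs telescope against the growth of the
  weight. Only the cross terms \<open>e j \<bullet> \<xi> j\<close> are kept exactly, as they will
  have mean zero.\<close>

lemma stopped_energy_bound:
  fixes e \<xi> :: "nat \<Rightarrow> 'a::real_inner" and a :: "nat \<Rightarrow> real" and T :: real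
  defines "S \<equiv> (\<lambda>n. \<Sum>k<n. a k)"
  defines "N \<equiv> LEAST n. T \<le> S n"
  assumes rec: "\<And>n. e (Suc n) = (1 - a n) *\<^sub>R e n + a n *\<^sub>R \<xi> n"
    and a: "\<And>n. 0 \<le> a n" "\<And>n. m \<le> n \<Longrightarrow> a n \<le> \<epsilon>" "\<epsilon> \<le> 1"
    and \<xi>: "\<And>n. norm (\<xi> n) \<le> R"
    and n: "m \<le> n" and m: "S m < T" and ex: "\<exists>n. T \<le> S n"
  shows "(norm (e (min n N)))\<^sup>2 * exp (S (min n N)) \<le>
    (norm (e m))\<^sup>2 * exp (S m) + 2 * \<epsilon> * R\<^sup>2 * (exp (S (min n N)) - exp (S m))
    + (\<Sum>j\<in>{m..<n}. (if S j < T then exp (S (Suc j)) * (2 * a j * (1 - a j)) else 0) * (e j \<bullet> \<xi> j))"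
proof -
  have S_mono: "S i \<le> S j" if "i \<le> j" for i j
    unfolding S_def using that a(1) by (intro sum_mono2) auto
  have TN: "T \<le> S N" unfolding N_def using ex by (rule LeastI_ex)
  \<comment> \<open>\<open>S\<close> is nondecreasing, so whether \<open>N\<close> is still ahead at
    time \<open>j\<close> is decided by \<open>S j\<close> alone. This makes the stopping indicator
    in the last sum predictable.\<close>
  have less_N: "j < N \<longleftrightarrow> S j < T" for j
  proof
    show "j < N \<Longrightarrow> S j < T" unfolding N_def using not_less_Least[of j "\<lambda>n. T \<le> S n"] by linarith
    show "S j < T \<Longrightarrow> j < N" using TN S_mono[of N j] by (cases "j < N") auto
  qed
  have one_step: "(norm (e (Suc j)))\<^sup>2 * exp (S (Suc j)) \<le> (norm (e j))\<^sup>2 * exp (S j)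
      + 2 * \<epsilon> * R\<^sup>2 * (exp (S (Suc j)) - exp (S j)) + exp (S (Suc j)) * (2 * a j * (1 - a j)) * (e j \<bullet> \<xi> j)"
    if j: "m \<le> j" for j
  proof -
    have aj: "0 \<le> a j" "a j \<le> \<epsilon>" "a j \<le> 1" using a(1)[of j] a(2)[OF j] a(3) by auto
    have SS: "exp (S (Suc j)) = exp (S j) * exp (a j)" by (simp add: S_def exp_add)
    have expand: "(norm (e (Suc j)))\<^sup>2 = (1 - a j)\<^sup>2 * (norm (e j))\<^sup>2
        + (a j)\<^sup>2 * (norm (\<xi> j))\<^sup>2 + 2 * a j * (1 - a j) * (e j \<bullet> \<xi> j)"
      unfolding rec power2_norm_eq_inner
      by (simp add: inner_add_left inner_add_right inner_commute algebra_simps power2_eq_square)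
    have "(1 - a j)\<^sup>2 * exp (a j) \<le> 1"
    proof -
      have "(1 - a j)\<^sup>2 \<le> 1 - a j" using aj by (simp add: power2_eq_square mult_left_le_one_le)
      also have "\<dots> \<le> exp (- a j)" using exp_ge_add_one_self[of "- a j"] by simp
      finally have "(1 - a j)\<^sup>2 * exp (a j) \<le> exp (- a j) * exp (a j)" by (intro mult_right_mono) auto
      then show ?thesis by (simp add: exp_minus)
    qed
    then have 1: "(1 - a j)\<^sup>2 * (norm (e j))\<^sup>2 * exp (S (Suc j)) \<le> (norm (e j))\<^sup>2 * exp (S j)"
      using mult_right_mono[of "(1 - a j)\<^sup>2 * exp (a j)" 1 "(norm (e j))\<^sup>2 * exp (S j)"]
      by (simp add: SS algebra_simps)
    \<comment> \<open>The noise of step \<open>j\<close> carries the later weight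
      \<open>exp (S (Suc j))\<close>; the factor 2 is the price for comparing it with the increment
      of the weight.\<close>
    have "a j * exp (a j) \<le> 2 * (exp (a j) - 1)"
    proof -
      have "(1 - a j / 2) * exp (a j) \<ge> 1"
      proof -
        have "exp (- a j) \<le> 1 / (1 + a j)"
          using exp_ge_add_one_self[of "a j"] aj by (simp add: exp_minus field_simps)
        also have "\<dots> \<le> 1 - a j / 2"
        proof -
          have "a j * a j \<le> a j" using aj by (simp add: mult_left_le_one_le)
          then show ?thesis using aj by (simp add: field_simps)
        qed
        finally have "exp (- a j) * exp (a j) \<le> (1 - a j / 2) * exp (a j)" by (intro mult_right_mono) auto
        then show ?thesis by (simp add: exp_minus)
      qed
      then show ?thesis by (simp add: algebra_simps)
    qed
    from mult_right_mono[OF this, of "exp (S j)"]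
    have "a j * exp (S (Suc j)) \<le> 2 * (exp (S (Suc j)) - exp (S j))"
      by (simp add: SS algebra_simps)
    moreover have "(a j)\<^sup>2 * (norm (\<xi> j))\<^sup>2 \<le> (\<epsilon> * a j) * R\<^sup>2"
      unfolding power2_eq_square[of "a j"] using aj \<xi>[of j]
      by (intro mult_mono power_mono) auto
    ultimately have "(a j)\<^sup>2 * (norm (\<xi> j))\<^sup>2 * exp (S (Suc j)) \<le> \<epsilon> * R\<^sup>2 * (2 * (exp (S (Suc j)) - exp (S j)))"
    proof -
      assume *: "a j * exp (S (Suc j)) \<le> 2 * (exp (S (Suc j)) - exp (S j))"
        and **: "(a j)\<^sup>2 * (norm (\<xi> j))\<^sup>2 \<le> (\<epsilon> * a j) * R\<^sup>2"
      have "(a j)\<^sup>2 * (norm (\<xi> j))\<^sup>2 * exp (S (Suc j)) \<le> (\<epsilon> * R\<^sup>2) * (a j * exp (S (Suc j)))"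
        using mult_right_mono[OF **, of "exp (S (Suc j))"] by (simp add: mult_ac)
      also have "\<dots> \<le> (\<epsilon> * R\<^sup>2) * (2 * (exp (S (Suc j)) - exp (S j)))"
        using * aj by (intro mult_left_mono) auto
      finally show ?thesis .
    qed
    with 1 show ?thesis unfolding expand by (simp add: algebra_simps)
  qed
  show ?thesis using n
  proof (induction n rule: dec_induct)
    case base
    have "m < N" using m less_N by simp
    then show ?case by simp
  next
    case (step n)
    show ?case
    proof (cases "n < N")
      case True
      then have "min (Suc n) N = Suc n" "min n N = n" "S n < T" using less_N[of n] by simp_all
      with step.IH step.hyps one_step[of n] show ?thesis by (simp add: algebra_simps)
    next
      case False
      \<comment> \<open>From \<open>N\<close> on both sides are frozen: \<open>min n N\<close> no
        longer moves, and the indicator removes the new cross term.\<close>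
      then have "min (Suc n) N = N" "min n N = N" "\<not> S n < T" using less_N[of n] by simp_all
      with step.IH step.hyps show ?thesis by simp
    qed
  qed
qed

text \<open>Balls are convex. This passes closeness of the single samples to the batch mean, and
  with centre 0 it bounds the batch mean.\<close>

lemma dist_mean_le:
  fixes f :: "'i \<Rightarrow> 'a::real_normed_vector"
  assumes A: "finite A" "A \<noteq> {}" and f: "\<And>i. i \<in> A \<Longrightarrow> dist c (f i) \<le> \<delta>"
  shows "dist c ((1 / real (card A)) *\<^sub>R (\<Sum>i\<in>A. f i)) \<le> \<delta>"
proof -
  have n: "0 < real (card A)" using A by (simp add: card_gt_0_iff)
  have "c - (1 / real (card A)) *\<^sub>R (\<Sum>i\<in>A. f i) = (1 / real (card A)) *\<^sub>R (\<Sum>i\<in>A. c - f i)"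
    using n by (simp add: sum_subtractf scaleR_diff_right sum_constant_scaleR)
  then have "dist c ((1 / real (card A)) *\<^sub>R (\<Sum>i\<in>A. f i)) = norm (\<Sum>i\<in>A. c - f i) / real (card A)"
    using n by (simp add: dist_norm)
  also have "norm (\<Sum>i\<in>A. c - f i) \<le> real (card A) * \<delta>"
    using f by (intro sum_norm_bound) (simp add: dist_norm)
  finally show ?thesis using n by (simp add: divide_right_mono field_simps)
qed

section \<open>Convergence of averaging processes\<close>

text \<open>The inner product is split over the basis. Each coordinate product of two independent
  real variables is integrable and its expectation factorizes, with a factor 0 from the
  noise.\<close>

lemma (in prob_space) indep_centered_inner:
  fixes Y \<xi> :: "'a \<Rightarrow> 'b::euclidean_space"
  assumes indep: "indep_set (sets G) (sigma_sets (space M) {\<xi> -` A \<inter> space M |A. A \<in> sets borel})"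
    and G: "space G = space M" and Y: "Y \<in> borel_measurable G" "integrable M Y"
    and \<xi>: "integrable M \<xi>" "expectation \<xi> = 0"
  shows "integrable M (\<lambda>\<omega>. Y \<omega> \<bullet> \<xi> \<omega>)" and "expectation (\<lambda>\<omega>. Y \<omega> \<bullet> \<xi> \<omega>) = 0"
proof -
  have GM: "sets G \<subseteq> events" using indep by (simp add: indep_sets2_eq)
  have *: "indep_var borel (\<lambda>\<omega>. Y \<omega> \<bullet> i) borel (\<lambda>\<omega>. \<xi> \<omega> \<bullet> i)" for i
    unfolding indep_var_eq
  proof (intro conjI)
    show "random_variable borel (\<lambda>\<omega>. Y \<omega> \<bullet> i)" "random_variable borel (\<lambda>\<omega>. \<xi> \<omega> \<bullet> i)"
      using Y \<xi> by simp_all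
    have Yi: "(\<lambda>\<omega>. Y \<omega> \<bullet> i) \<in> borel_measurable G" using Y(1) by simp
    have 1: "sigma_sets (space M) {(\<lambda>\<omega>. Y \<omega> \<bullet> i) -` A \<inter> space M |A. A \<in> sets borel} \<subseteq> sets G"
      using measurable_sets[OF Yi] unfolding G[symmetric] by (intro sets.sigma_sets_subset) auto
    have 2: "sigma_sets (space M) {(\<lambda>\<omega>. \<xi> \<omega> \<bullet> i) -` A \<inter> space M |A. A \<in> sets borel}
      \<subseteq> sigma_sets (space M) {\<xi> -` A \<inter> space M |A. A \<in> sets borel}"
    proof (intro sigma_sets_mono subsetI, safe)
      fix A :: "real set" assume "A \<in> sets borel"
      then have "(\<lambda>x. x \<bullet> i) -` A \<in> sets borel"
        using measurable_sets[of "\<lambda>x::'b. x \<bullet> i" borel borel A] by simp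
      then show "(\<lambda>\<omega>. \<xi> \<omega> \<bullet> i) -` A \<inter> space M \<in> sigma_sets (space M) {\<xi> -` A \<inter> space M |A. A \<in> sets borel}"
        by (intro sigma_sets.Basic) (auto simp: vimage_def)
    qed
    show "indep_set (sigma_sets (space M) {(\<lambda>\<omega>. Y \<omega> \<bullet> i) -` A \<inter> space M |A. A \<in> sets borel})
      (sigma_sets (space M) {(\<lambda>\<omega>. \<xi> \<omega> \<bullet> i) -` A \<inter> space M |A. A \<in> sets borel})"
      unfolding indep_sets2_eq
    proof (intro conjI ballI)
      note ind = indep[unfolded indep_sets2_eq]
      show "sigma_sets (space M) {(\<lambda>\<omega>. Y \<omega> \<bullet> i) -` A \<inter> space M |A. A \<in> sets borel} \<subseteq> events"
        using 1 GM by (rule order_trans)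
      show "sigma_sets (space M) {(\<lambda>\<omega>. \<xi> \<omega> \<bullet> i) -` A \<inter> space M |A. A \<in> sets borel} \<subseteq> events"
        using 2 ind by (blast intro: order_trans)
      fix A B assume "A \<in> sigma_sets (space M) {(\<lambda>\<omega>. Y \<omega> \<bullet> i) -` A \<inter> space M |A. A \<in> sets borel}"
        and "B \<in> sigma_sets (space M) {(\<lambda>\<omega>. \<xi> \<omega> \<bullet> i) -` A \<inter> space M |A. A \<in> sets borel}"
      then have "A \<in> sets G" "B \<in> sigma_sets (space M) {\<xi> -` A \<inter> space M |A. A \<in> sets borel}"
        using 1 2 by blast+
      then show "prob (A \<inter> B) = prob A * prob B" using ind by (elim conjE) simp
    qed
  qed
  have "(\<lambda>\<omega>. Y \<omega> \<bullet> \<xi> \<omega>) = (\<lambda>\<omega>. \<Sum>i\<in>Basis. (Y \<omega> \<bullet> i) * (\<xi> \<omega> \<bullet> i))"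
    by (rule ext, rule euclidean_inner)
  moreover have "integrable M (\<lambda>\<omega>. (Y \<omega> \<bullet> i) * (\<xi> \<omega> \<bullet> i))" for i
    using Y \<xi> by (intro indep_var_integrable[OF *]) auto
  moreover have "expectation (\<lambda>\<omega>. (Y \<omega> \<bullet> i) * (\<xi> \<omega> \<bullet> i)) = 0" for i
    using Y \<xi> indep_var_lebesgue_integral[OF *, of i] by (simp add: integral_inner_left)
  ultimately show "integrable M (\<lambda>\<omega>. Y \<omega> \<bullet> \<xi> \<omega>)" "expectation (\<lambda>\<omega>. Y \<omega> \<bullet> \<xi> \<omega>) = 0"
    by (simp_all add: Bochner_Integration.integral_sum)
qed

text \<open>State \<open>e n\<close> and rate \<open>a n\<close> are known at time \<open>n\<close>,
  while the noise \<open>\<xi> n\<close> is independent of \<open>F n\<close>. The deterministic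
  minorants \<open>b\<close> force the accumulated rates to reach any level by a non-random index;
  the majorant \<open>\<alpha> < 2\<close> keeps the recursion bounded.\<close>

locale averaging_process = prob_space M for M :: "'w measure" +
  fixes F :: "nat \<Rightarrow> 'w measure" and e \<xi> :: "nat \<Rightarrow> 'w \<Rightarrow> 'a::euclidean_space"
    and a :: "nat \<Rightarrow> 'w \<Rightarrow> real" and b :: "nat \<Rightarrow> real" and \<alpha> R :: real
  assumes space_F: "space (F n) = space M"
    and F_mono: "i \<le> j \<Longrightarrow> sets (F i) \<subseteq> sets (F j)"
    and e_F: "e n \<in> borel_measurable (F n)"
    and a_F: "a n \<in> borel_measurable (F n)"
    and xi_M: "\<xi> n \<in> borel_measurable M"
    and indep: "indep_set (sets (F n)) (sigma_sets (space M) {\<xi> n -` A \<inter> space M |A. A \<in> sets borel})"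
    and xi_le: "AE \<omega> in M. norm (\<xi> n \<omega>) \<le> R"
    and xi_mean: "expectation (\<xi> n) = 0"
    and rec: "\<omega> \<in> space M \<Longrightarrow> e (Suc n) \<omega> = (1 - a n \<omega>) *\<^sub>R e n \<omega> + a n \<omega> *\<^sub>R \<xi> n \<omega>"
    and b_pos: "0 < b n" and b_le: "\<omega> \<in> space M \<Longrightarrow> b n \<le> a n \<omega>"
    and b_sum: "filterlim (\<lambda>n. \<Sum>k<n. b k) at_top sequentially"
    and a_le: "\<omega> \<in> space M \<Longrightarrow> a n \<omega> \<le> \<alpha>" and \<alpha>: "\<alpha> < 2"
    and a_decr: "\<omega> \<in> space M \<Longrightarrow> i \<le> j \<Longrightarrow> a j \<omega> \<le> a i \<omega>"
    and a_lim: "AE \<omega> in M. (\<lambda>n. a n \<omega>) \<longlonglongrightarrow> 0"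
    and e0: "integrable M (\<lambda>\<omega>. (norm (e 0 \<omega>))\<^sup>2)"
begin

definition S :: "nat \<Rightarrow> 'w \<Rightarrow> real" where "S n \<omega> = (\<Sum>k<n. a k \<omega>)"
definition N :: "real \<Rightarrow> 'w \<Rightarrow> nat" where "N T \<omega> = (LEAST n. T \<le> S n \<omega>)"
text \<open>The integrable majorant of all squared errors at once: the square of the maximum in
  \<open>averaging_bounded\<close> is at most the sum of the squares.\<close>

definition H :: "'w \<Rightarrow> real" where "H \<omega> = (norm (e 0 \<omega>))\<^sup>2 + (2 * R / (2 - \<alpha>))\<^sup>2"

lemma sets_F: "sets (F n) \<subseteq> events"
  using indep[of n] by (simp add: indep_sets2_eq)

lemma measurable_F_mono: "f \<in> borel_measurable (F i) \<Longrightarrow> i \<le> j \<Longrightarrow> f \<in> borel_measurable (F j)"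
  using F_mono[of i j] measurable_mono[of borel borel "F i" "F j"] by (auto simp: space_F)

lemma measurable_F_M: "f \<in> borel_measurable (F i) \<Longrightarrow> f \<in> borel_measurable M"
  using sets_F[of i] measurable_mono[of borel borel "F i" M] by (auto simp: space_F)

lemma a_pos: "\<omega> \<in> space M \<Longrightarrow> 0 < a n \<omega>"
  using b_pos[of n] b_le[of \<omega> n] by linarith

lemma all_xi_le: "AE \<omega> in M. \<forall>n. norm (\<xi> n \<omega>) \<le> R"
  using xi_le by (simp add: AE_all_countable)

lemma xi_integrable: "integrable M (\<xi> n)"
  using xi_le[of n] xi_M[of n] by (intro integrable_const_bound) auto

lemma H_integrable: "integrable M H"
  unfolding H_def using e0 by simp

lemma H_nonneg: "0 \<le> H \<omega>"
  by (simp add: H_def)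

lemma norm_e_sq_le:
  assumes "\<omega> \<in> space M" "\<forall>n. norm (\<xi> n \<omega>) \<le> R"
  shows "(norm (e n \<omega>))\<^sup>2 \<le> H \<omega>"
proof -
  have "norm (e n \<omega>) \<le> max (norm (e 0 \<omega>)) (2 * R / (2 - \<alpha>))"
    using assms \<alpha> by (intro averaging_bounded[where a="\<lambda>n. a n \<omega>" and \<xi>="\<lambda>n. \<xi> n \<omega>"] rec a_le less_imp_le[OF a_pos]) auto
  then have "(norm (e n \<omega>))\<^sup>2 \<le> (max (norm (e 0 \<omega>)) (2 * R / (2 - \<alpha>)))\<^sup>2" by (intro power_mono) auto
  also have "\<dots> \<le> H \<omega>" by (simp add: H_def max_def)
  finally show ?thesis .
qed

lemma e_integrable: "integrable M (e n)"
proof -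
  have "integrable M (\<lambda>\<omega>. (norm (e n \<omega>))\<^sup>2)"
  proof (rule Bochner_Integration.integrable_bound[OF H_integrable])
    show "(\<lambda>\<omega>. (norm (e n \<omega>))\<^sup>2) \<in> borel_measurable M" using measurable_F_M[OF e_F] by simp
    show "AE \<omega> in M. norm ((norm (e n \<omega>))\<^sup>2) \<le> norm (H \<omega>)"
      using all_xi_le AE_space by eventually_elim (simp add: norm_e_sq_le H_nonneg)
  qed
  then have "integrable M (\<lambda>\<omega>. norm (e n \<omega>))"
    using measurable_F_M[OF e_F, of n] by (intro square_integrable_imp_integrable[of "\<lambda>\<omega>. norm (e n \<omega>)"]) simp_all
  then show ?thesis using measurable_F_M[OF e_F] by (simp add: integrable_norm_iff)
qed

lemma S_unbounded: "\<omega> \<in> space M \<Longrightarrow> T \<le> (\<Sum>k<n. b k) \<Longrightarrow> T \<le> S n \<omega>"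
  unfolding S_def using sum_mono[of "{..<n}" b "\<lambda>k. a k \<omega>"] b_le by fastforce

text \<open>The predictable factor of \<open>\<xi>\<^sub>j\<close> in the centred part of the energy increment, switched off unless the rate at
  time \<open>m\<close> is at most \<open>\<epsilon>\<close> and level \<open>T\<close> is not yet reached.\<close>
definition Y :: "real \<Rightarrow> nat \<Rightarrow> real \<Rightarrow> nat \<Rightarrow> 'w \<Rightarrow> 'a" where
  "Y T m \<epsilon> j \<omega> = (if a m \<omega> \<le> \<epsilon> \<and> S j \<omega> < T then exp (S (Suc j) \<omega>) * (2 * a j \<omega> * (1 - a j \<omega>)) else 0) *\<^sub>R e j \<omega>"

lemma Y_F: "m \<le> j \<Longrightarrow> Y T m \<epsilon> j \<in> borel_measurable (F j)"
proof -
  assume "m \<le> j"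
  have [measurable]: "a i \<in> borel_measurable (F j)" if "i \<le> j" for i using a_F[of i] that by (rule measurable_F_mono)
  have [measurable]: "a m \<in> borel_measurable (F j)" "a j \<in> borel_measurable (F j)" using \<open>m \<le> j\<close> by simp_all
  \<comment> \<open>\<open>S (Suc j)\<close> involves only the rates up to \<open>a j\<close>, so it
    is still known at time \<open>j\<close>.\<close>
  have [measurable]: "S j \<in> borel_measurable (F j)" "S (Suc j) \<in> borel_measurable (F j)" unfolding S_def by measurable
  have [measurable]: "e j \<in> borel_measurable (F j)" by (rule e_F)
  show ?thesis unfolding Y_def by measurable
qed

text \<open>Below level \<open>T\<close> one more rate, less than 2, is added, so the weight is at
  most \<open>exp (T + 2)\<close>; the factor \<open>2 * a * (1 - a)\<close> is at most 4 in
  absolute value. Integrability of \<open>e j\<close> then suffices.\<close>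

lemma Y_integrable: "m \<le> j \<Longrightarrow> integrable M (Y T m \<epsilon> j)"
proof (rule Bochner_Integration.integrable_bound[where f="\<lambda>\<omega>. (exp (T + 2) * 4) *\<^sub>R e j \<omega>"])
  assume "m \<le> j"
  then show "Y T m \<epsilon> j \<in> borel_measurable M" by (rule measurable_F_M[OF Y_F])
  show "integrable M (\<lambda>\<omega>. (exp (T + 2) * 4) *\<^sub>R e j \<omega>)" using e_integrable by simp
  have "norm (Y T m \<epsilon> j \<omega>) \<le> norm ((exp (T + 2) * 4) *\<^sub>R e j \<omega>)" if "\<omega> \<in> space M" for \<omega>
  proof (cases "a m \<omega> \<le> \<epsilon> \<and> S j \<omega> < T")
    case True
    have aj: "0 < a j \<omega>" "a j \<omega> < 2" using a_pos[OF that, of j] a_le[OF that, of j] \<alpha> by auto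
    have "exp (S (Suc j) \<omega>) \<le> exp (T + 2)" using True aj by (simp add: S_def)
    moreover have "\<bar>2 * a j \<omega> * (1 - a j \<omega>)\<bar> \<le> 4 * 1"
      unfolding abs_mult using aj by (intro mult_mono) auto
    ultimately have "\<bar>exp (S (Suc j) \<omega>) * (2 * a j \<omega> * (1 - a j \<omega>))\<bar> \<le> exp (T + 2) * 4"
      unfolding abs_mult[of "exp _"] by (intro mult_mono) auto
    then show ?thesis using True by (simp add: Y_def mult_right_mono)
  qed (auto simp: Y_def)
  then show "AE \<omega> in M. norm (Y T m \<epsilon> j \<omega>) \<le> norm ((exp (T + 2) * 4) *\<^sub>R e j \<omega>)" by simp
qed

section \<open>The energy when the accumulated rates reach level T\<close>

text \<open>If the rate at time \<open>m\<close> exceeds \<open>\<epsilon>\<close>, domination by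
  \<open>H\<close> is all there is. Otherwise \<open>stopped_energy_bound\<close>, started at
  \<open>m\<close>, is divided by \<open>exp T\<close>. The start contributes at most
  \<open>H\<close> times \<open>exp (m * \<alpha>)\<close>; the level is overshot by less than 2,
  hence the factor \<open>exp 2\<close>. The condition \<open>m * \<alpha> < T\<close> ensures that
  \<open>T\<close> is not reached by time \<open>m\<close>.\<close>

lemma energy_at_N:
  assumes \<omega>: "\<omega> \<in> space M" and xi: "\<forall>n. norm (\<xi> n \<omega>) \<le> R"
    and T: "real m * \<alpha> < T" "T \<le> (\<Sum>k<n. b k)" and \<epsilon>: "0 \<le> \<epsilon>" "\<epsilon> \<le> 1"
  shows "(norm (e (N T \<omega>) \<omega>))\<^sup>2 \<le> exp (real m * \<alpha> - T) * H \<omega> + 2 * \<epsilon> * R\<^sup>2 * exp 2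
    + H \<omega> * indicator {\<omega>. \<epsilon> < a m \<omega>} \<omega> + exp (- T) * (\<Sum>j\<in>{m..<n}. Y T m \<epsilon> j \<omega> \<bullet> \<xi> j \<omega>)"
proof (cases "a m \<omega> \<le> \<epsilon>")
  case False
  then have "Y T m \<epsilon> j \<omega> = 0" for j by (simp add: Y_def)
  with False show ?thesis using norm_e_sq_le[OF \<omega> xi, of "N T \<omega>"] H_nonneg[of \<omega>] \<epsilon>
    by (simp add: add_increasing)
next
  case True
  have Tn: "T \<le> S n \<omega>" using S_unbounded[OF \<omega> T(2)] .
  then have Nn: "N T \<omega> \<le> n" unfolding N_def by (rule Least_le)
  have TN: "T \<le> S (N T \<omega>) \<omega>" unfolding N_def using Tn by (rule LeastI)
  have Sm: "S m \<omega> \<le> real m * \<alpha>"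
    unfolding S_def using sum_bounded_above[of "{..<m}" "\<lambda>k. a k \<omega>" \<alpha>] a_le[OF \<omega>] by simp
  have S0: "0 \<le> S m \<omega>" unfolding S_def using a_pos[OF \<omega>] by (intro sum_nonneg) (simp add: less_imp_le)
  have mn: "m \<le> n"
  proof (rule ccontr)
    assume "\<not> m \<le> n"
    then have "S n \<omega> \<le> S m \<omega>" unfolding S_def using a_pos[OF \<omega>] by (intro sum_mono2) (auto intro: less_imp_le)
    with Tn Sm T(1) show False by simp
  qed
  have SN: "S (N T \<omega>) \<omega> \<le> T + 2"
  proof (cases "N T \<omega>")
    case 0
    with S0 Sm T(1) show ?thesis by (simp add: S_def)
  next
    case (Suc i)
    then have "S i \<omega> < T" unfolding N_def using not_less_Least[of i "\<lambda>n. T \<le> S n \<omega>"] by linarith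
    with Suc a_le[OF \<omega>, of i] \<alpha> show ?thesis by (simp add: S_def)
  qed
  have a_eps: "a j \<omega> \<le> \<epsilon>" if "m \<le> j" for j
    using a_decr[OF \<omega> that] True by simp
  have "(norm (e (min n (N T \<omega>)) \<omega>))\<^sup>2 * exp (S (min n (N T \<omega>)) \<omega>)
    \<le> (norm (e m \<omega>))\<^sup>2 * exp (S m \<omega>) + 2 * \<epsilon> * R\<^sup>2 * (exp (S (min n (N T \<omega>)) \<omega>) - exp (S m \<omega>))
    + (\<Sum>j\<in>{m..<n}. (if S j \<omega> < T then exp (S (Suc j) \<omega>) * (2 * a j \<omega> * (1 - a j \<omega>)) else 0) * (e j \<omega> \<bullet> \<xi> j \<omega>))"
    unfolding N_def S_def
    using a_pos[OF \<omega>] xi mn a_eps \<epsilon> Sm T(1) Tn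
    by (intro stopped_energy_bound rec \<omega>) (auto simp: S_def intro: less_imp_le)
  also have "(\<Sum>j\<in>{m..<n}. (if S j \<omega> < T then exp (S (Suc j) \<omega>) * (2 * a j \<omega> * (1 - a j \<omega>)) else 0) * (e j \<omega> \<bullet> \<xi> j \<omega>))
    = (\<Sum>j\<in>{m..<n}. Y T m \<epsilon> j \<omega> \<bullet> \<xi> j \<omega>)" (is "_ = ?Z")
    using True by (intro sum.cong) (auto simp: Y_def)
  also have "min n (N T \<omega>) = N T \<omega>" using Nn by simp
  finally have 1: "(norm (e (N T \<omega>) \<omega>))\<^sup>2 * exp (S (N T \<omega>) \<omega>)
    \<le> (norm (e m \<omega>))\<^sup>2 * exp (S m \<omega>) + 2 * \<epsilon> * R\<^sup>2 * (exp (S (N T \<omega>) \<omega>) - exp (S m \<omega>)) + ?Z" .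
  have "(norm (e (N T \<omega>) \<omega>))\<^sup>2 * exp T \<le> (norm (e (N T \<omega>) \<omega>))\<^sup>2 * exp (S (N T \<omega>) \<omega>)"
    using TN by (intro mult_left_mono) auto
  also note 1
  also have "(norm (e m \<omega>))\<^sup>2 * exp (S m \<omega>) \<le> H \<omega> * exp (real m * \<alpha>)"
    using Sm norm_e_sq_le[OF \<omega> xi] by (intro mult_mono) (auto simp: H_nonneg)
  also have "2 * \<epsilon> * R\<^sup>2 * (exp (S (N T \<omega>) \<omega>) - exp (S m \<omega>)) \<le> 2 * \<epsilon> * R\<^sup>2 * exp (T + 2)"
  proof (intro mult_left_mono)
    have "exp (S (N T \<omega>) \<omega>) \<le> exp (T + 2)" using SN by simp
    then show "exp (S (N T \<omega>) \<omega>) - exp (S m \<omega>) \<le> exp (T + 2)" using exp_gt_zero[of "S m \<omega>"] by linarith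
  qed (use \<epsilon> in auto)
  finally have "(norm (e (N T \<omega>) \<omega>))\<^sup>2 * exp T * exp (- T)
    \<le> (H \<omega> * exp (real m * \<alpha>) + 2 * \<epsilon> * R\<^sup>2 * exp (T + 2) + ?Z) * exp (- T)"
    by (intro mult_right_mono) auto
  also have "\<dots> = exp (real m * \<alpha> - T) * H \<omega> + 2 * \<epsilon> * R\<^sup>2 * exp 2 + exp (- T) * ?Z"
    by (simp add: exp_add exp_diff exp_minus field_simps)
  also have "(norm (e (N T \<omega>) \<omega>))\<^sup>2 * exp T * exp (- T) = (norm (e (N T \<omega>) \<omega>))\<^sup>2"
    by (simp add: exp_minus)
  finally show ?thesis using True by simp
qed

lemma expected_energy_at_N:
  assumes T: "real m * \<alpha> < T" and \<epsilon>: "0 \<le> \<epsilon>" "\<epsilon> \<le> 1"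
  shows "(\<integral>\<^sup>+\<omega>. ennreal ((norm (e (N T \<omega>) \<omega>))\<^sup>2) \<partial>M) \<le>
    ennreal (exp (real m * \<alpha> - T) * expectation H + 2 * \<epsilon> * R\<^sup>2 * exp 2
      + expectation (\<lambda>\<omega>. H \<omega> * indicator {\<omega>. \<epsilon> < a m \<omega>} \<omega>))"
proof -
  \<comment> \<open>A horizon that does not depend on the path, so that the cross terms form a sum
    over a fixed range and their expectations vanish one by one.\<close>
  obtain n where n: "T \<le> (\<Sum>k<n. b k)"
    using b_sum unfolding filterlim_at_top by (meson eventually_sequentially order_refl)
  define Z where "Z = (\<lambda>\<omega>. \<Sum>j\<in>{m..<n}. Y T m \<epsilon> j \<omega> \<bullet> \<xi> j \<omega>)"
  define Q where "Q = (\<lambda>\<omega>. exp (real m * \<alpha> - T) * H \<omega> + 2 * \<epsilon> * R\<^sup>2 * exp 2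
    + H \<omega> * indicator {\<omega>. \<epsilon> < a m \<omega>} \<omega> + exp (- T) * Z \<omega>)"
  have Y: "integrable M (\<lambda>\<omega>. Y T m \<epsilon> j \<omega> \<bullet> \<xi> j \<omega>)" "expectation (\<lambda>\<omega>. Y T m \<epsilon> j \<omega> \<bullet> \<xi> j \<omega>) = 0" if "m \<le> j" for j
    using indep_centered_inner[OF indep space_F Y_F[OF that] Y_integrable[OF that] xi_integrable xi_mean] by auto
  have Z: "integrable M Z" unfolding Z_def using Y(1) by (intro Bochner_Integration.integrable_sum) auto
  have Z0: "expectation Z = 0"
    unfolding Z_def by (subst Bochner_Integration.integral_sum) (auto simp: Y)
  have am: "a m \<in> borel_measurable M" using measurable_F_M[OF a_F] .
  have I: "integrable M (\<lambda>\<omega>. H \<omega> * indicator {\<omega>. \<epsilon> < a m \<omega>} \<omega>)"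
  proof (rule Bochner_Integration.integrable_bound[OF H_integrable])
    have "H \<in> borel_measurable M" using H_integrable by simp
    with am show "(\<lambda>\<omega>. H \<omega> * indicator {\<omega>. \<epsilon> < a m \<omega>} \<omega>) \<in> borel_measurable M"
      by (simp add: indicator_def of_bool_def)
  qed (auto simp: indicator_def)
  have Q: "AE \<omega> in M. (norm (e (N T \<omega>) \<omega>))\<^sup>2 \<le> Q \<omega>"
    unfolding Q_def Z_def using all_xi_le AE_space by eventually_elim (intro energy_at_N T n \<epsilon>)
  have QI: "integrable M Q"
    unfolding Q_def using I H_integrable Z by simp
  have "(\<integral>\<^sup>+\<omega>. ennreal ((norm (e (N T \<omega>) \<omega>))\<^sup>2) \<partial>M) \<le> (\<integral>\<^sup>+\<omega>. ennreal (Q \<omega>) \<partial>M)"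
    using Q by (intro nn_integral_mono_AE) (auto intro: ennreal_leI)
  \<comment> \<open>\<open>Z\<close> has no sign, but \<open>Q\<close> is nonnegative almost
    everywhere because it dominates a square.\<close>
  also have "\<dots> = ennreal (expectation Q)"
    by (rule nn_integral_eq_integral[OF QI]) (use Q in \<open>eventually_elim, use zero_le_power2 order_trans in blast\<close>)
  also have "expectation Q = exp (real m * \<alpha> - T) * expectation H + 2 * \<epsilon> * R\<^sup>2 * exp 2
      + expectation (\<lambda>\<omega>. H \<omega> * indicator {\<omega>. \<epsilon> < a m \<omega>} \<omega>)"
    unfolding Q_def using I H_integrable Z by (simp add: prob_space Z0)
  finally show ?thesis .
qed

text \<open>Along almost every path the rates eventually fall below \<open>\<epsilon>\<close>, so
  the indicator is eventually 0; \<open>H\<close> dominates.\<close>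

lemma tail_expectation:
  assumes "0 < \<epsilon>"
  shows "(\<lambda>m. expectation (\<lambda>\<omega>. H \<omega> * indicator {\<omega>. \<epsilon> < a m \<omega>} \<omega>)) \<longlonglongrightarrow> 0"
proof -
  have "(\<lambda>m. expectation (\<lambda>\<omega>. H \<omega> * indicator {\<omega>. \<epsilon> < a m \<omega>} \<omega>)) \<longlonglongrightarrow> expectation (\<lambda>\<omega>. 0)"
  proof (rule integral_dominated_convergence[where w=H])
    show "integrable M H" by (rule H_integrable)
    show "AE \<omega> in M. (\<lambda>m. H \<omega> * indicator {\<omega>. \<epsilon> < a m \<omega>} \<omega>) \<longlonglongrightarrow> 0"
      using a_lim
    proof eventually_elim
      case (elim \<omega>)
      then have "eventually (\<lambda>m. a m \<omega> < \<epsilon>) sequentially" using assms by (rule order_tendstoD)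
      then have "eventually (\<lambda>m. H \<omega> * indicator {\<omega>. \<epsilon> < a m \<omega>} \<omega> = 0) sequentially"
        by eventually_elim simp
      then show ?case by (rule tendsto_eventually)
    qed
    fix m
    have "H \<in> borel_measurable M" "a m \<in> borel_measurable M" using H_integrable measurable_F_M[OF a_F] by auto
    then show "(\<lambda>\<omega>. H \<omega> * indicator {\<omega>. \<epsilon> < a m \<omega>} \<omega>) \<in> borel_measurable M"
      by (simp add: indicator_def of_bool_def)
  qed (auto simp: indicator_def H_nonneg)
  then show ?thesis by simp
qed

theorem energy_at_N_tendsto_0: "((\<lambda>T. \<integral>\<^sup>+\<omega>. ennreal ((norm (e (N T \<omega>) \<omega>))\<^sup>2) \<partial>M) \<longlongrightarrow> 0) at_top"
proof (rule tendsto_zero_ennreal)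
  fix r :: real assume r: "0 < r"
  \<comment> \<open>The choices are made in the order \<open>\<epsilon>\<close>, \<open>m\<close>,
    \<open>T\<close>, each of the three error terms receiving \<open>r / 4\<close>. The minimum with
    1 meets the requirement \<open>\<epsilon> \<le> 1\<close>, and the summand 1 beside
    \<open>R\<^sup>2\<close> avoids a zero denominator.\<close>
  define \<epsilon> where "\<epsilon> = min 1 (r / (8 * ((R\<^sup>2 + 1) * exp 2)))"
  have \<epsilon>: "0 < \<epsilon>" "\<epsilon> \<le> 1" using r by (auto simp: \<epsilon>_def add_nonneg_pos)
  have "\<epsilon> \<le> r / (8 * ((R\<^sup>2 + 1) * exp 2))" by (simp add: \<epsilon>_def)
  then have "\<epsilon> * (8 * ((R\<^sup>2 + 1) * exp 2)) \<le> r" by (subst (asm) pos_le_divide_eq) (auto simp: add_nonneg_pos)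
  moreover have "2 * \<epsilon> * R\<^sup>2 * exp 2 \<le> \<epsilon> * (2 * ((R\<^sup>2 + 1) * exp 2))" using \<epsilon> by (simp add: algebra_simps)
  ultimately have 2: "2 * \<epsilon> * R\<^sup>2 * exp 2 \<le> r / 4" by simp
  obtain m where m: "expectation (\<lambda>\<omega>. H \<omega> * indicator {\<omega>. \<epsilon> < a m \<omega>} \<omega>) < r / 4"
    using order_tendstoD(2)[OF tail_expectation[OF \<epsilon>(1)], of "r / 4"] r
    by (auto simp: eventually_sequentially)
  have "((\<lambda>T. exp (real m * \<alpha> - T) * expectation H) \<longlongrightarrow> 0) at_top"
  proof -
    have "((\<lambda>T. exp (c - T) * d) \<longlongrightarrow> 0) at_top" for c d :: real by real_asymp
    then show ?thesis .
  qed
  then have "eventually (\<lambda>T. exp (real m * \<alpha> - T) * expectation H < r / 4) at_top"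
    by (rule order_tendstoD) (use r in simp)
  then show "eventually (\<lambda>T. (\<integral>\<^sup>+\<omega>. ennreal ((norm (e (N T \<omega>) \<omega>))\<^sup>2) \<partial>M) < ennreal r) at_top"
    using eventually_gt_at_top[of "real m * \<alpha>"]
  proof eventually_elim
    case (elim T)
    have "(\<integral>\<^sup>+\<omega>. ennreal ((norm (e (N T \<omega>) \<omega>))\<^sup>2) \<partial>M) \<le> ennreal (exp (real m * \<alpha> - T) * expectation H + 2 * \<epsilon> * R\<^sup>2 * exp 2
      + expectation (\<lambda>\<omega>. H \<omega> * indicator {\<omega>. \<epsilon> < a m \<omega>} \<omega>))"
      using elim \<epsilon> by (intro expected_energy_at_N) auto
    also have "\<dots> < ennreal r" using elim 2 m r by (intro ennreal_lessI) auto
    finally show ?case .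
  qed
qed

end

section \<open>Independent families\<close>

lemma (in prob_space) indep_vars_reindex:
  assumes X: "indep_vars M' X I" and f: "inj_on f J" "f ` J \<subseteq> I"
  shows "indep_vars (\<lambda>j. M' (f j)) (\<lambda>j. X (f j)) J"
  unfolding indep_vars_def2
proof (intro conjI ballI indep_setsI)
  have rv: "random_variable (M' (f j)) (X (f j))" if "j \<in> J" for j
    using X f that by (auto simp: indep_vars_def)
  show "random_variable (M' (f j)) (X (f j))" if "j \<in> J" for j using rv that .
  show "{X (f j) -` A \<inter> space M |A. A \<in> sets (M' (f j))} \<subseteq> events" if "j \<in> J" for j
    using measurable_sets[OF rv[OF that]] by auto
  fix A L assume L: "L \<noteq> {}" "L \<subseteq> J" "finite L"
    and A: "\<forall>j\<in>L. A j \<in> {X (f j) -` A \<inter> space M |A. A \<in> sets (M' (f j))}"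
  have inj: "inj_on f L" using f(1) L(2) by (rule inj_on_subset)
  have "prob (\<Inter>i\<in>f ` L. A (inv_into L f i)) = (\<Prod>i\<in>f ` L. prob (A (inv_into L f i)))"
  proof (rule indep_setsD)
    show "indep_sets (\<lambda>i. {X i -` A \<inter> space M |A. A \<in> sets (M' i)}) I" using X by (simp add: indep_vars_def2)
    show "\<forall>i\<in>f ` L. A (inv_into L f i) \<in> {X i -` A \<inter> space M |A. A \<in> sets (M' i)}"
      using A inj by (auto simp: inv_into_f_f)
  qed (use L f in auto)
  then show "prob (\<Inter>j\<in>L. A j) = (\<Prod>j\<in>L. prob (A j))"
    using inj by (simp add: prod.reindex inv_into_f_f)
qed

text \<open>Putting the initial value under \<open>None\<close> yields one independent family, so
  that past and future become disjoint index sets. A finite intersection splits into an event of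
  \<open>T\<close> and an event of the whole family \<open>W\<close>, which \<open>ind\<close>
  separates; the latter then factorizes by independence of \<open>W\<close>.\<close>

lemma (in prob_space) indep_vars_case_option:
  fixes W :: "'i \<Rightarrow> 'a \<Rightarrow> 'b::topological_space"
  assumes W: "indep_vars (\<lambda>_. borel) W UNIV" and T: "T \<in> borel_measurable M"
    and ind: "indep_set (sets (vimage_algebra (space M) (\<lambda>\<omega> i. W i \<omega>) (PiM UNIV (\<lambda>_. borel))))
      (sets (vimage_algebra (space M) T borel))"
  shows "indep_vars (\<lambda>_. borel) (case_option T W) UNIV"
  unfolding indep_vars_def2
proof (intro conjI ballI indep_setsI)
  have rv: "W i \<in> borel_measurable M" for i using W by (auto simp: indep_vars_def)
  show rv': "case_option T W i \<in> borel_measurable M" for i by (cases i) (auto simp: T rv)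
  show "{case_option T W i -` A \<inter> space M |A. A \<in> sets borel} \<subseteq> events" for i
    using measurable_sets[OF rv'] by auto
  fix A :: "'i option \<Rightarrow> 'a set" and J :: "'i option set"
  assume J: "J \<noteq> {}" "finite J" and A: "\<forall>j\<in>J. A j \<in> {case_option T W j -` A \<inter> space M |A. A \<in> sets borel}"
  define L where "L = {i. Some i \<in> J}"
  have L: "finite L" using finite_vimageI[OF J(2), of Some] by (simp add: L_def vimage_def)
  have AW: "\<forall>i\<in>L. A (Some i) \<in> {W i -` A \<inter> space M |A. A \<in> sets borel}" using A by (force simp: L_def)
  have indW: "indep_sets (\<lambda>i. {W i -` A \<inter> space M |A. A \<in> sets borel}) UNIV"
    using W by (simp add: indep_vars_def2)
  have prodW: "prob (\<Inter>i\<in>L. A (Some i)) = (\<Prod>i\<in>L. prob (A (Some i)))" if "L \<noteq> {}"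
    using indep_setsD[OF indW _ that L AW] by simp
  show "prob (\<Inter> (A ` J)) = (\<Prod>j\<in>J. prob (A j))"
  proof (cases "None \<in> J")
    case False
    then have JL: "J = Some ` L" unfolding L_def by (auto simp: image_iff) (metis not_None_eq)
    then show ?thesis using prodW J(1) by (simp add: prod.reindex image_image)
  next
    case True
    then have JL: "J = insert None (Some ` L)" unfolding L_def by (auto simp: image_iff) (metis not_None_eq)
    show ?thesis
    proof (cases "L = {}")
      case True
      then show ?thesis by (simp add: JL)
    next
      case False
      have "A None \<in> sets (vimage_algebra (space M) T borel)"
        using A True by (force intro: in_vimage_algebra)
      moreover have "(\<Inter>i\<in>L. A (Some i)) \<in> sets (vimage_algebra (space M) (\<lambda>\<omega> i. W i \<omega>) (PiM UNIV (\<lambda>_. borel)))"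
      proof (rule sets.finite_INT[OF L False])
        fix i assume "i \<in> L"
        then obtain B where B: "B \<in> sets borel" "A (Some i) = W i -` B \<inter> space M" using AW by blast
        have "(\<lambda>f. f i) -` B \<inter> space (PiM UNIV (\<lambda>_. borel)) \<in> sets (PiM UNIV (\<lambda>_. borel))"
          by (rule measurable_sets[OF _ B(1)]) simp
        from in_vimage_algebra[OF this, of "\<lambda>\<omega> i. W i \<omega>" "space M"]
        show "A (Some i) \<in> sets (vimage_algebra (space M) (\<lambda>\<omega> i. W i \<omega>) (PiM UNIV (\<lambda>_. borel)))"
          by (simp add: B(2) space_PiM vimage_def)
      qed
      ultimately have "prob ((\<Inter>i\<in>L. A (Some i)) \<inter> A None) = prob (\<Inter>i\<in>L. A (Some i)) * prob (A None)"
        by (intro indep_setD[OF ind])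
      then show ?thesis
        using L prodW[OF False] by (simp add: JL prod.reindex image_image Int_commute mult.commute)
    qed
  qed
qed

definition generated_by :: "'w set \<Rightarrow> ('i \<Rightarrow> 'w \<Rightarrow> 'b::topological_space) \<Rightarrow> 'i set \<Rightarrow> 'w measure" where
  "generated_by \<Omega> W I = sigma \<Omega> (\<Union>i\<in>I. {W i -` A \<inter> \<Omega> |A. A \<in> sets borel})"

lemma space_generated_by: "space (generated_by \<Omega> W I) = \<Omega>"
  unfolding generated_by_def by (rule space_measure_of) auto

lemma sets_generated_by:
  "sets (generated_by \<Omega> W I) = sigma_sets \<Omega> (\<Union>i\<in>I. {W i -` A \<inter> \<Omega> |A. A \<in> sets borel})"
  unfolding generated_by_def by (rule sets_measure_of) auto

lemma sets_generated_by_mono: "I \<subseteq> J \<Longrightarrow> sets (generated_by \<Omega> W I) \<subseteq> sets (generated_by \<Omega> W J)"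
  unfolding sets_generated_by by (rule sigma_sets_mono') auto

lemma measurable_generated_by: "i \<in> I \<Longrightarrow> W i \<in> borel_measurable (generated_by \<Omega> W I)"
  by (rule measurableI) (auto simp: space_generated_by sets_generated_by intro!: sigma_sets.Basic)

text \<open>The generators of each index are closed under intersection, so independence passes to
  the sigma-algebras generated by disjoint groups of indices, and \<open>f\<close> only sees the
  group \<open>J\<close>.\<close>

lemma (in prob_space) indep_set_generated_by:
  assumes W: "indep_vars (\<lambda>_. borel) W UNIV" and disj: "I \<inter> J = {}"
    and f: "f \<in> borel_measurable (generated_by (space M) W J)"
  shows "indep_set (sets (generated_by (space M) W I)) (sigma_sets (space M) {f -` A \<inter> space M |A. A \<in> sets borel})"
proof -
  let ?E = "\<lambda>i. {W i -` A \<inter> space M |A. A \<in> sets borel}"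
  have E: "indep_sets ?E UNIV" using W by (simp add: indep_vars_def2)
  have "indep_sets (\<lambda>b. sigma_sets (space M) (\<Union>i\<in>case_bool I J b. ?E i)) UNIV"
  proof (rule indep_sets_collect_sigma)
    show "indep_sets ?E (\<Union>b\<in>UNIV. case_bool I J b)" using E by (rule indep_sets_mono_index[rotated]) auto
    show "Int_stable (?E i)" for i
    proof (rule Int_stableI)
      fix a b assume "a \<in> ?E i" "b \<in> ?E i"
      then obtain A B where "A \<in> sets borel" "B \<in> sets borel" "a = W i -` A \<inter> space M" "b = W i -` B \<inter> space M" by blast
      then show "a \<inter> b \<in> ?E i" by (intro CollectI exI[of _ "A \<inter> B"]) auto
    qed
    show "disjoint_family_on (case_bool I J) UNIV"
      using disj by (auto simp: disjoint_family_on_def split: bool.splits)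
  qed
  then have "indep_set (sets (generated_by (space M) W I)) (sets (generated_by (space M) W J))"
    unfolding indep_set_def sets_generated_by
    by (rule iffD1[OF indep_sets_cong, rotated 2]) (auto split: bool.split)
  moreover have "sigma_sets (space M) {f -` A \<inter> space M |A. A \<in> sets borel} \<subseteq> sets (generated_by (space M) W J)"
    using measurable_sets[OF f] sets.sigma_sets_subset[of "{f -` A \<inter> space M |A. A \<in> sets borel}" "generated_by (space M) W J"]
    by (auto simp: space_generated_by)
  ultimately show ?thesis unfolding indep_sets2_eq by blast
qed

section \<open>Events that recur infinitely often\<close>

text \<open>Continuity from above gives the limsup event probability at least \<open>c\<close>;
  being positive, it is 1 by the zero-one law.\<close>

lemma (in prob_space) indep_events_infinitely_often:
  fixes A :: "nat \<Rightarrow> 'a set"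
  assumes A: "indep_events A UNIV" and c: "0 < c" "\<And>n. c \<le> prob (A n)"
  shows "AE \<omega> in M. \<forall>m. \<exists>n\<ge>m. \<omega> \<in> A n"
proof -
  have ev: "A n \<in> events" for n using A by (auto simp: indep_events_def)
  have "(\<lambda>n. prob (\<Union>m\<in>{n..}. A m)) \<longlonglongrightarrow> prob (\<Inter>n. \<Union>m\<in>{n..}. A m)"
  proof (rule finite_Lim_measure_decseq)
    show "decseq (\<lambda>n. \<Union>m\<in>{n..}. A m)" unfolding decseq_def by (intro allI impI UN_mono) auto
  qed (use ev in auto)
  moreover have "c \<le> prob (\<Union>m\<in>{n..}. A m)" for n
    using c(2)[of n] ev by (intro order_trans[OF c(2)[of n]] finite_measure_mono) auto
  ultimately have "c \<le> prob (\<Inter>n. \<Union>m\<in>{n..}. A m)" by (intro LIMSEQ_le_const) auto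
  with c(1) borel_0_1_law[OF A] have "prob (\<Inter>n. \<Union>m\<in>{n..}. A m) = 1" by auto
  then have "AE \<omega> in M. \<omega> \<in> (\<Inter>n. \<Union>m\<in>{n..}. A m)" using ev by (intro AE_prob_1) auto
  then show ?thesis by eventually_elim auto
qed

text \<open>Otherwise every threshold \<open>k\<close> is exceeded with a positive probability that
  is the same for all \<open>n\<close>, hence almost surely by some \<open>n\<close>. Doing this for
  all \<open>k\<close> at once contradicts boundedness of the paths.\<close>

lemma (in prob_space) iid_bounded_imp_AE_bounded:
  fixes V :: "nat \<Rightarrow> 'a \<Rightarrow> 'b::real_normed_vector"
  assumes V: "indep_vars (\<lambda>_. borel) V UNIV" and ident: "\<And>n. distr M borel (V n) = distr M borel (V 0)"
    and bdd: "AE \<omega> in M. \<exists>c. \<forall>n. norm (V n \<omega>) \<le> c"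
  shows "\<exists>c. AE \<omega> in M. norm (V 0 \<omega>) \<le> c"
proof (rule ccontr)
  assume *: "\<nexists>c. AE \<omega> in M. norm (V 0 \<omega>) \<le> c"
  have rv[measurable]: "V n \<in> borel_measurable M" for n using V by (auto simp: indep_vars_def)
  have "AE \<omega> in M. \<exists>n. real k < norm (V n \<omega>)" for k
  proof -
    define c where "c = measure (distr M borel (V 0)) {x. real k < norm x}"
    have prob: "prob {\<omega> \<in> space M. real k < norm (V n \<omega>)} = c" for n
    proof -
      have "c = measure (distr M borel (V n)) {x. real k < norm x}" unfolding c_def ident[of n] ..
      also have "\<dots> = prob (V n -` {x. real k < norm x} \<inter> space M)" by (intro measure_distr) auto
      also have "V n -` {x. real k < norm x} \<inter> space M = {\<omega> \<in> space M. real k < norm (V n \<omega>)}" by auto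
      finally show ?thesis by simp
    qed
    have "c \<noteq> 0"
    proof
      assume "c = 0"
      then have "AE \<omega> in M. \<omega> \<notin> {\<omega> \<in> space M. real k < norm (V 0 \<omega>)}"
        using prob[of 0] prob_eq_0[of "{\<omega> \<in> space M. real k < norm (V 0 \<omega>)}"] by simp
      then have "AE \<omega> in M. norm (V 0 \<omega>) \<le> real k" using AE_space by eventually_elim auto
      with * show False by blast
    qed
    then have "0 < c" unfolding c_def by (simp add: zero_less_measure_iff)
    moreover have "indep_events (\<lambda>n. {\<omega> \<in> space M. real k < norm (V n \<omega>)}) UNIV"
      by (rule indep_eventsI_indep_vars[OF V]) auto
    ultimately have "AE \<omega> in M. \<forall>m. \<exists>n\<ge>m. \<omega> \<in> {\<omega> \<in> space M. real k < norm (V n \<omega>)}"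
      using prob by (intro indep_events_infinitely_often) auto
    then show ?thesis by eventually_elim blast
  qed
  then have "AE \<omega> in M. \<forall>k::nat. \<exists>n. real k < norm (V n \<omega>)" by (simp add: AE_all_countable)
  with bdd have "AE \<omega> in M. False"
  proof eventually_elim
    case (elim \<omega>)
    then obtain c where c: "\<And>n. norm (V n \<omega>) \<le> c" by blast
    obtain k :: nat where "c \<le> real k" using real_arch_simple by blast
    with elim(2) c show False by (meson not_less order_trans)
  qed
  then show False by simp
qed

text \<open>Injectivity of \<open>\<iota>\<close> gives each \<open>j\<close> its own block of
  indices. The block events are therefore independent, and their common probability is a finite
  product of positive numbers.\<close>

lemma (in prob_space) iid_blocks_infinitely_often:
  fixes W :: "'i \<Rightarrow> 'a \<Rightarrow> 'b::topological_space" and \<iota> :: "nat \<Rightarrow> 'd \<Rightarrow> 'i"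
  assumes W: "indep_vars (\<lambda>_. borel) W UNIV" and ident: "\<And>i. distr M borel (W i) = \<mu>"
    and D: "finite D" "D \<noteq> {}" and inj: "inj_on (\<lambda>(j, d). \<iota> j d) (UNIV \<times> D)"
    and B: "\<And>d. d \<in> D \<Longrightarrow> B d \<in> sets borel" "\<And>d. d \<in> D \<Longrightarrow> 0 < emeasure \<mu> (B d)"
  shows "AE \<omega> in M. \<forall>m. \<exists>j\<ge>m. \<forall>d\<in>D. W (\<iota> j d) \<omega> \<in> B d"
proof -
  have rv[measurable]: "W i \<in> borel_measurable M" for i using W by (auto simp: indep_vars_def)
  have inj_j: "inj_on (\<iota> j) D" for j
    using inj by (auto simp: inj_on_def)
  define K where "K j = \<iota> j ` D" for j
  have "disjoint_family_on K UNIV"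
    using inj by (auto simp: disjoint_family_on_def K_def inj_on_def)
  then have ind: "indep_vars (\<lambda>j. PiM (K j) (\<lambda>_. borel)) (\<lambda>j \<omega>. restrict (\<lambda>i. W i \<omega>) (K j)) UNIV"
    by (intro indep_vars_restrict[OF W]) auto
  define E where "E j = {\<omega> \<in> space M. \<forall>d\<in>D. W (\<iota> j d) \<omega> \<in> B d}" for j
  have "{f \<in> space (PiM (K j) (\<lambda>_. borel)). \<forall>d\<in>D. f (\<iota> j d) \<in> B d} \<in> sets (PiM (K j) (\<lambda>_. borel))" for j
  proof (intro sets.sets_Collect_finite_All D)
    fix d assume d: "d \<in> D"
    have "(\<lambda>f. f (\<iota> j d)) \<in> measurable (PiM (K j) (\<lambda>_. borel)) borel"
      using d by (intro measurable_component_singleton) (auto simp: K_def)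
    from measurable_sets[OF this B(1)[OF d]]
    show "{f \<in> space (PiM (K j) (\<lambda>_. borel)). f (\<iota> j d) \<in> B d} \<in> sets (PiM (K j) (\<lambda>_. borel))"
      by (simp add: vimage_def Int_def conj_commute)
  qed
  from indep_eventsI_indep_vars[OF ind this]
  have "indep_events (\<lambda>j. {\<omega> \<in> space M. \<forall>d\<in>D. restrict (\<lambda>i. W i \<omega>) (K j) (\<iota> j d) \<in> B d}) UNIV" by simp
  also have "(\<lambda>j. {\<omega> \<in> space M. \<forall>d\<in>D. restrict (\<lambda>i. W i \<omega>) (K j) (\<iota> j d) \<in> B d}) = E"
    by (auto simp: E_def K_def fun_eq_iff)
  finally have indE: "indep_events E UNIV" .
  have "prob (E j) = (\<Prod>d\<in>D. measure \<mu> (B d))" for j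
  proof -
    have B': "B (inv_into D (\<iota> j) i) \<in> sets borel" if "i \<in> K j" for i
      using that by (auto simp: K_def intro!: B(1) inv_into_into)
    have "E j = (\<Inter>i\<in>K j. W i -` B (inv_into D (\<iota> j) i) \<inter> space M)"
      using D inj_j by (auto simp: E_def K_def inv_into_f_f)
    also have "prob \<dots> = (\<Prod>i\<in>K j. prob (W i -` B (inv_into D (\<iota> j) i) \<inter> space M))"
      using D by (intro indep_varsD[OF W] B') (auto simp: K_def)
    also have "\<dots> = (\<Prod>i\<in>K j. measure \<mu> (B (inv_into D (\<iota> j) i)))"
      using B' by (intro prod.cong refl) (simp add: measure_distr[OF rv, unfolded ident, symmetric])
    also have "\<dots> = (\<Prod>d\<in>D. measure \<mu> (B d))"
      unfolding K_def using inj_j by (subst prod.reindex) (auto simp: inv_into_f_f)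
    finally show ?thesis .
  qed
  moreover have "0 < (\<Prod>d\<in>D. measure \<mu> (B d))"
  proof (rule prod_pos)
    fix d assume "d \<in> D"
    interpret \<mu>: prob_space \<mu> using prob_space_distr[OF rv, of undefined] by (simp add: ident)
    show "0 < measure \<mu> (B d)" using B(2)[OF \<open>d \<in> D\<close>] by (simp add: \<mu>.emeasure_eq_measure)
  qed
  ultimately have "AE \<omega> in M. \<forall>m. \<exists>n\<ge>m. \<omega> \<in> E n"
    by (intro indep_events_infinitely_often[OF indE]) auto
  then show ?thesis by eventually_elim (auto simp: E_def)
qed

section \<open>Long runs of data near two support points\<close>

text \<open>A nonempty open subset of a Euclidean space is not a singleton.\<close>

lemma two_points_in_support:
  fixes f :: "'w \<Rightarrow> 'a::euclidean_space"
  assumes "non_degenerate P f"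
  obtains x0 x1 where "x0 \<noteq> x1" "x0 \<in> measure_support (distr P borel f)" "x1 \<in> measure_support (distr P borel f)"
proof -
  define U where "U = interior (measure_support (distr P borel f))"
  obtain x0 where x0: "x0 \<in> U" using assms by (auto simp: non_degenerate_def U_def)
  have "U \<noteq> {x0}" using not_open_singleton[of x0] open_interior by (metis U_def)
  with x0 obtain x1 where "x1 \<in> U" "x1 \<noteq> x0" by blast
  with x0 that show ?thesis using interior_subset unfolding U_def by blast
qed

lemma emeasure_cball_support_pos:
  fixes x :: "'a::metric_space"
  assumes "x \<in> measure_support \<mu>" "sets \<mu> = sets borel" "0 < \<delta>"
  shows "0 < emeasure \<mu> (cball x \<delta>)"
proof -
  have "0 < emeasure \<mu> (ball x \<delta>)" using assms by (auto simp: measure_support_def)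
  also have "\<dots> \<le> emeasure \<mu> (cball x \<delta>)" using assms by (intro emeasure_mono ball_subset_cball) auto
  finally show ?thesis .
qed

text \<open>The rows are cut into disjoint windows of length \<open>Suc J\<close>, shifted by 1
  because the step from time \<open>n\<close> to \<open>n + 1\<close> uses row \<open>n + 1\<close>.
  Training data sit in positive columns, validation data in negative ones.\<close>

lemma (in prob_space) blocks_near_two_points:
  fixes X :: "int \<Rightarrow> int \<Rightarrow> 'a \<Rightarrow> 'b::metric_space" and p q :: nat
  assumes X: "indep_vars (\<lambda>_. borel) (\<lambda>(n, m). X n m) UNIV"
    and ident: "\<And>n m. distr M borel (X n m) = \<mu>"
    and x: "x0 \<in> measure_support \<mu>" "x1 \<in> measure_support \<mu>" and \<delta>: "0 < \<delta>"
  shows "AE \<omega> in M. \<forall>n0. \<exists>n\<ge>n0. (\<forall>i<J. \<forall>m\<in>{1..int p}. dist x0 (X (int (n + i) + 1) m \<omega>) \<le> \<delta>)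
    \<and> (\<forall>m\<in>{1..int p}. dist x1 (X (int (n + J) + 1) m \<omega>) \<le> \<delta>)
    \<and> (\<forall>m\<in>{1..int q}. dist x0 (X (int (n + J) + 1) (- m) \<omega>) \<le> \<delta>)"
proof -
  \<comment> \<open>One rectangle of indices carries all constraints: only the training columns of
    the last row are sent to \<open>x1\<close>, everything else in the window to
    \<open>x0\<close>.\<close>
  define D where "D = {..J} \<times> {- int q..int p}"
  define \<iota> where "\<iota> = (\<lambda>j (i, m :: int). (int (j * Suc J + i) + 1, m))"
  define B where "B = (\<lambda>(i, m :: int). if i = J \<and> 1 \<le> m then cball x1 \<delta> else cball x0 \<delta>)"
  have sets: "sets \<mu> = sets borel" using ident[of 0 0] by (metis sets_distr)
  have "AE \<omega> in M. \<forall>m. \<exists>j\<ge>m. \<forall>d\<in>D. (\<lambda>(n, m). X n m) (\<iota> j d) \<omega> \<in> B d"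
  proof (rule iid_blocks_infinitely_often[OF X])
    show "distr M borel (case i of (n, m) \<Rightarrow> X n m) = \<mu>" for i using ident by (cases i) auto
    show "finite D" "D \<noteq> {}" by (auto simp: D_def)
    show "inj_on (\<lambda>(j, d). \<iota> j d) (UNIV \<times> D)"
    proof (rule inj_onI)
      fix s t assume "s \<in> UNIV \<times> D" "t \<in> UNIV \<times> D" and eq: "(\<lambda>(j, d). \<iota> j d) s = (\<lambda>(j, d). \<iota> j d) t"
      then obtain j i m j' i' m' where st: "s = (j, i, m)" "t = (j', i', m')" and i: "i < Suc J" "i' < Suc J"
        by (cases s, cases t) (auto simp: D_def)
      have m: "m = m'" and e: "j * Suc J + i = j' * Suc J + i'" using eq by (simp_all add: st \<iota>_def del: of_nat_add of_nat_mult of_nat_Suc mult_Suc_right)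
      \<comment> \<open>Window number and offset are recovered as quotient and remainder.\<close>
      have "(j * Suc J + i) div Suc J = j" "(j' * Suc J + i') div Suc J = j'"
        "(j * Suc J + i) mod Suc J = i" "(j' * Suc J + i') mod Suc J = i'"
        using i by (simp_all del: mult_Suc_right)
      with e m st show "s = t" by metis
    qed
    fix d assume "d \<in> D"
    show "B d \<in> sets borel" by (auto simp: B_def split: prod.split)
    show "0 < emeasure \<mu> (B d)" using emeasure_cball_support_pos[OF x(1) sets \<delta>] emeasure_cball_support_pos[OF x(2) sets \<delta>]
      by (auto simp: B_def split: prod.split)
  qed
  then show ?thesis
  proof eventually_elim
    case (elim \<omega>)
    show ?case
    proof
      fix n0
      obtain j where j: "n0 \<le> j" "\<And>d. d \<in> D \<Longrightarrow> (\<lambda>(n, m). X n m) (\<iota> j d) \<omega> \<in> B d" using elim by blast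
      have *: "X (int (j * Suc J + i) + 1) m \<omega> \<in> B (i, m)" if "i \<le> J" "- int q \<le> m" "m \<le> int p" for i m
        using j(2)[of "(i, m)"] that by (simp add: D_def \<iota>_def)
      show "\<exists>n\<ge>n0. (\<forall>i<J. \<forall>m\<in>{1..int p}. dist x0 (X (int (n + i) + 1) m \<omega>) \<le> \<delta>)
        \<and> (\<forall>m\<in>{1..int p}. dist x1 (X (int (n + J) + 1) m \<omega>) \<le> \<delta>)
        \<and> (\<forall>m\<in>{1..int q}. dist x0 (X (int (n + J) + 1) (- m) \<omega>) \<le> \<delta>)"
      proof (intro exI[of _ "j * Suc J"] conjI allI impI ballI)
        show "n0 \<le> j * Suc J" using j(1) by simp
        show "dist x0 (X (int (j * Suc J + i) + 1) m \<omega>) \<le> \<delta>" if "i < J" "m \<in> {1..int p}" for i m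
          using *[of i m] that by (simp add: B_def)
        show "dist x1 (X (int (j * Suc J + J) + 1) m \<omega>) \<le> \<delta>" if "m \<in> {1..int p}" for m
          using *[of J m] that by (simp add: B_def)
        show "dist x0 (X (int (j * Suc J + J) + 1) (- m) \<omega>) \<le> \<delta>" if "m \<in> {1..int q}" for m
          using *[of J "- m"] that by (simp add: B_def)
      qed
    qed
  qed
qed

section \<open>Step sizes\<close>

text \<open>Each term bounds the limsup from above, so all terms are nonnegative, and strictly
  positive because the next one is smaller. The liminf is then at least 0 and meets the
  limsup.\<close>

lemma decreasing_limsup_0:
  fixes \<nu> :: "nat \<Rightarrow> real"
  assumes decr: "\<And>n k. 1 \<le> n \<Longrightarrow> n < k \<Longrightarrow> \<nu> k < \<nu> n"
    and lim: "limsup (\<lambda>n. ereal (\<nu> n)) = 0"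
  shows "\<nu> \<longlonglongrightarrow> 0" and "1 \<le> k \<Longrightarrow> 0 < \<nu> k"
proof -
  have ge: "0 \<le> \<nu> k" if "1 \<le> k" for k
  proof -
    have "eventually (\<lambda>n. ereal (\<nu> n) \<le> ereal (\<nu> k)) sequentially"
      using eventually_gt_at_top[of k] by eventually_elim (use decr that in \<open>auto intro: less_imp_le\<close>)
    then have "limsup (\<lambda>n. ereal (\<nu> n)) \<le> ereal (\<nu> k)" by (rule Limsup_bounded)
    then show ?thesis using lim by simp
  qed
  show pos: "0 < \<nu> k" if "1 \<le> k" for k
    using ge[of "Suc k"] decr[of k "Suc k"] that by simp
  have "liminf (\<lambda>n. ereal (\<nu> n)) \<ge> 0"
    by (rule Liminf_bounded) (use eventually_ge_at_top[of 1] in \<open>eventually_elim, simp add: ge\<close>)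
  moreover have "liminf (\<lambda>n. ereal (\<nu> n)) \<le> limsup (\<lambda>n. ereal (\<nu> n))" by (rule Liminf_le_Limsup) simp
  ultimately have "(\<lambda>n. ereal (\<nu> n)) \<longlonglongrightarrow> 0"
    using lim by (intro limsup_le_liminf_real[of _ 0, simplified zero_ereal_def] Liminf_eq_Limsup) (auto simp: zero_ereal_def)
  then show "\<nu> \<longlonglongrightarrow> 0" by (simp add: zero_ereal_def)
qed

text \<open>Turns the maximum in the step size rule into a shift of the index by one.\<close>

lemma greatest_below:
  fixes \<nu> :: "nat \<Rightarrow> real"
  assumes decr: "\<And>n k. 1 \<le> n \<Longrightarrow> n < k \<Longrightarrow> \<nu> k < \<nu> n"
    and pos: "\<And>k. 1 \<le> k \<Longrightarrow> 0 < \<nu> k" and k: "1 \<le> k"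
  shows "(GREATEST r. r \<in> {0<..<\<nu> k} \<inter> {\<nu> j | j. j \<ge> 1}) = \<nu> (Suc k)"
proof (rule Greatest_equality)
  show "\<nu> (Suc k) \<in> {0<..<\<nu> k} \<inter> {\<nu> j | j. j \<ge> 1}"
    using decr[of k "Suc k"] pos[of "Suc k"] k by auto
  fix y assume "y \<in> {0<..<\<nu> k} \<inter> {\<nu> j | j. j \<ge> 1}"
  then obtain j where j: "1 \<le> j" "y = \<nu> j" "\<nu> j < \<nu> k" by auto
  then have "k < j" using decr[of j k] by (cases j k rule: linorder_cases) auto
  then show "y \<le> \<nu> (Suc k)" using decr[of "Suc k" j] j(2) by (cases "j = Suc k") auto
qed

text \<open>A nondecreasing sequence of naturals that is never eventually constant is
  unbounded.\<close>

lemma unbounded_index_tendsto_0: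
  fixes \<nu> :: "nat \<Rightarrow> real" and K :: "nat \<Rightarrow> nat"
  assumes \<nu>: "\<nu> \<longlonglongrightarrow> 0" and mono: "\<And>n. K n \<le> K (Suc n)"
    and nonconst: "\<And>k m. \<exists>n\<ge>m. K n \<noteq> k"
  shows "(\<lambda>n. \<nu> (K n)) \<longlonglongrightarrow> 0"
proof -
  have inc: "K i \<le> K j" if "i \<le> j" for i j using lift_Suc_mono_le[of K, OF mono that] .
  have "\<exists>n. k \<le> K n" for k
  proof (induction k)
    case (Suc k)
    then obtain n where n: "k \<le> K n" by blast
    obtain n' where "n \<le> n'" "K n' \<noteq> k" using nonconst by blast
    with inc[of n n'] n show ?case by (intro exI[of _ n']) auto
  qed auto
  then have "filterlim K at_top sequentially"
    unfolding filterlim_at_top eventually_sequentially using inc by (meson order_trans)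
  with \<nu> show ?thesis by (rule filterlim_compose)
qed

text \<open>After \<open>J\<close> samples near \<open>x0\<close> the iterate is near
  \<open>x0\<close> too, and so is the validation point \<open>y\<close>; one sample near
  \<open>x1\<close> then pulls it away. With \<open>u = x J - \<theta> J\<close> and
  \<open>v = y - \<theta> J\<close> the squared distance to \<open>y\<close> changes by
  \<open>a * (a * (norm u)\<^sup>2 - 2 * (u \<bullet> v))\<close>, positive once
  \<open>2 * norm v < a * norm u\<close>. The choice of \<open>\<delta>\<close> and \<open>J\<close>
  does not depend on the trajectory, only on the bound \<open>C\<close> for its start.\<close>

lemma constant_step_overshoots:
  fixes x0 x1 :: "'a::real_inner"
  assumes a: "0 < a" "a < 2" and x: "x0 \<noteq> x1"
  obtains \<delta> J where "0 < \<delta>"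
    "\<And>\<theta> x y. \<lbrakk>\<And>i. i \<le> J \<Longrightarrow> \<theta> (Suc i) = (1 - a) *\<^sub>R \<theta> i + a *\<^sub>R x i; norm (\<theta> 0) \<le> C;
      \<And>i. i < J \<Longrightarrow> dist x0 (x i) \<le> \<delta>; dist x1 (x J) \<le> \<delta>; dist x0 y \<le> \<delta>\<rbrakk>
      \<Longrightarrow> (norm (\<theta> J - y))\<^sup>2 < (norm (\<theta> (Suc J) - y))\<^sup>2"
proof -
  define D where "D = dist x0 x1"
  have D: "0 < D" using x by (simp add: D_def)
  define \<rho> where "\<rho> = \<bar>1 - a\<bar>"
  have \<rho>: "0 \<le> \<rho>" "\<rho> < 1" using a by (auto simp: \<rho>_def)
  define C' where "C' = \<bar>C\<bar> + norm x0"
  \<comment> \<open>Serves two purposes: \<open>\<delta> \<le> a * D / 32\<close>, and the limiting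
    error \<open>a * \<delta> / (1 - \<rho>)\<close> of the contraction with factor
    \<open>\<rho>\<close> is at most \<open>a * D / 16\<close>. \<open>J\<close> is chosen so that
    the memory of the start also falls below \<open>a * D / 16\<close>.\<close>
  define \<delta> where "\<delta> = a * D * (1 - \<rho>) / 32"
  have \<delta>: "0 < \<delta>" using a D \<rho> by (simp add: \<delta>_def)
  have "(\<lambda>J. \<rho> ^ J * C') \<longlonglongrightarrow> 0" using \<rho> by (intro tendsto_mult_left_zero LIMSEQ_realpow_zero)
  then have "eventually (\<lambda>J. \<rho> ^ J * C' < a * D / 16) sequentially"
    using a D by (intro order_tendstoD) auto
  then obtain J where J: "\<rho> ^ J * C' < a * D / 16" by (auto simp: eventually_sequentially)
  show ?thesis
  proof (rule that[OF \<delta>, of J])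
    fix \<theta> x :: "nat \<Rightarrow> 'a" and y :: 'a
    assume rec: "\<And>i. i \<le> J \<Longrightarrow> \<theta> (Suc i) = (1 - a) *\<^sub>R \<theta> i + a *\<^sub>R x i" and C: "norm (\<theta> 0) \<le> C"
      and near: "\<And>i. i < J \<Longrightarrow> dist x0 (x i) \<le> \<delta>" "dist x1 (x J) \<le> \<delta>" "dist x0 y \<le> \<delta>"
    have "norm (\<theta> i - x0) \<le> \<rho> ^ i * C' + a * \<delta> / (1 - \<rho>)" if "i \<le> J" for i
      using that
    proof (induction i)
      case 0
      have "norm (\<theta> 0 - x0) \<le> C'" using norm_triangle_ineq4[of "\<theta> 0" x0] C by (simp add: C'_def)
      moreover have "0 \<le> a * \<delta> / (1 - \<rho>)" using a \<delta> \<rho> by simp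
      ultimately show ?case by simp
    next
      case (Suc i)
      have "\<theta> (Suc i) - x0 = (1 - a) *\<^sub>R (\<theta> i - x0) + a *\<^sub>R (x i - x0)"
        using rec[of i] Suc.prems by (simp add: algebra_simps)
      then have "norm (\<theta> (Suc i) - x0) \<le> \<rho> * norm (\<theta> i - x0) + a * norm (x i - x0)"
        using norm_triangle_ineq[of "(1 - a) *\<^sub>R (\<theta> i - x0)" "a *\<^sub>R (x i - x0)"] a by (simp add: \<rho>_def)
      also have "\<dots> \<le> \<rho> * (\<rho> ^ i * C' + a * \<delta> / (1 - \<rho>)) + a * \<delta>"
        using Suc a \<rho> near(1)[of i] by (intro add_mono mult_left_mono) (auto simp: dist_norm norm_minus_commute)
      also have "\<dots> = \<rho> ^ Suc i * C' + a * \<delta> / (1 - \<rho>)" using \<rho> by (simp add: field_simps)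
      finally show ?case .
    qed
    from this[of J] J have "norm (\<theta> J - x0) < a * D / 16 + a * \<delta> / (1 - \<rho>)" by simp
    also have "a * \<delta> / (1 - \<rho>) = a * (a * D) / 32"
    proof -
      have "a * (a * D * s / 32) / s = a * (a * D) / 32" if "s \<noteq> 0" for s using that by simp
      from this[of "1 - \<rho>"] show ?thesis using \<rho> by (simp add: \<delta>_def)
    qed
    also have "\<dots> \<le> a * D / 16" using mult_right_mono[of a 2 "a * D"] a D by simp
    finally have \<theta>J: "norm (\<theta> J - x0) < a * D / 8" by linarith
    have \<delta>le: "\<delta> \<le> a * D / 32" using a D \<rho> mult_left_mono[of "1 - \<rho>" 1 "a * D"] by (simp add: \<delta>_def)
    have n: "norm (y - x0) \<le> \<delta>" "norm (x J - x1) \<le> \<delta>" "D = norm (x1 - x0)" "0 < a * D"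
      using near(2,3) D a by (auto simp: dist_norm norm_minus_commute D_def)
    define u where "u = x J - \<theta> J"
    define v where "v = y - \<theta> J"
    have v: "norm v < a * D / 6"
    proof -
      have "v = (y - x0) - (\<theta> J - x0)" by (simp add: v_def)
      then have "norm v \<le> norm (y - x0) + norm (\<theta> J - x0)" using norm_triangle_ineq4 by metis
      then show ?thesis using \<theta>J \<delta>le n by linarith
    qed
    have u: "D - a * D / 6 < norm u"
    proof -
      have eq: "x1 - x0 = u + ((\<theta> J - x0) - (x J - x1))" by (simp add: u_def)
      have "norm (x1 - x0) \<le> norm u + (norm (\<theta> J - x0) + norm (x J - x1))"
        unfolding eq
        using norm_triangle_ineq[of u "(\<theta> J - x0) - (x J - x1)"]
          norm_triangle_ineq4[of "\<theta> J - x0" "x J - x1"] by linarith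
      then show ?thesis using \<theta>J \<delta>le n by linarith
    qed
    \<comment> \<open>Thus \<open>norm u\<close> exceeds two thirds of \<open>D\<close>, whereas
      \<open>norm v\<close> is below \<open>a * D / 6\<close>.\<close>
    have aD: "a * D < 2 * D" using a D by simp
    have "2 * norm v < a * norm u"
    proof -
      have "a * (D - D / 3) \<le> a * norm u" using u aD a by (intro mult_left_mono) auto
      moreover have "a * (D - D / 3) = 2 / 3 * (a * D)" by (simp add: field_simps)
      ultimately show ?thesis using v n(4) by linarith
    qed
    moreover have "0 < norm u" using u aD D by linarith
    ultimately have "2 * (norm u * norm v) < a * (norm u)\<^sup>2"
      using mult_strict_right_mono[of "2 * norm v" "a * norm u" "norm u"] by (simp add: power2_eq_square mult_ac)
    then have "2 * (u \<bullet> v) < a * (norm u)\<^sup>2" using norm_cauchy_schwarz[of u v] by linarith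
    then have "0 < a * (a * (norm u)\<^sup>2 - 2 * (u \<bullet> v))" using a by simp
    moreover have "(norm (\<theta> (Suc J) - y))\<^sup>2 = (norm (\<theta> J - y))\<^sup>2 + a * (a * (norm u)\<^sup>2 - 2 * (u \<bullet> v))"
    proof -
      have "\<theta> (Suc J) - y = a *\<^sub>R u - v" "\<theta> J - y = - v" using rec[of J] by (simp_all add: u_def v_def algebra_simps)
      then show ?thesis
        by (simp only: power2_norm_eq_inner) (simp add: inner_diff_left inner_diff_right inner_commute algebra_simps)
    qed
    ultimately show "(norm (\<theta> J - y))\<^sup>2 < (norm (\<theta> (Suc J) - y))\<^sup>2" by simp
  qed
qed

text \<open>If the index were eventually constant, the rate would be constant from some time on. A
  later block, with \<open>\<delta>\<close> and \<open>J\<close> taken for this rate, makes every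
  validation summand grow, so the index increases after all.\<close>

lemma adaptive_steps_tendsto_0:
  fixes \<theta> x :: "nat \<Rightarrow> 'a::real_inner" and v :: "nat \<Rightarrow> 'v \<Rightarrow> 'a" and \<nu> :: "nat \<Rightarrow> real" and K :: "nat \<Rightarrow> nat"
  assumes rec: "\<And>n. \<theta> (Suc n) = (1 - c * \<nu> (K n)) *\<^sub>R \<theta> n + (c * \<nu> (K n)) *\<^sub>R x n"
    and bdd: "\<And>n. norm (\<theta> n) \<le> C"
    and step: "\<And>k. 1 \<le> k \<Longrightarrow> 0 < c * \<nu> k" "\<And>k. 1 \<le> k \<Longrightarrow> c * \<nu> k < 2"
    and V: "finite V" "V \<noteq> {}"
    and K0: "1 \<le> K 0" and K_Suc: "\<And>n. K (Suc n) =
      (if (\<Sum>m\<in>V. (norm (\<theta> (Suc n) - v n m))\<^sup>2) \<le> (\<Sum>m\<in>V. (norm (\<theta> n - v n m))\<^sup>2) then K n else Suc (K n))"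
    and x: "x0 \<noteq> x1"
    and blocks: "\<And>\<delta> J n0. 0 < \<delta> \<Longrightarrow> \<exists>n\<ge>n0. (\<forall>i<J. dist x0 (x (n + i)) \<le> \<delta>) \<and> dist x1 (x (n + J)) \<le> \<delta>
      \<and> (\<forall>m\<in>V. dist x0 (v (n + J) m) \<le> \<delta>)"
    and \<nu>: "\<nu> \<longlonglongrightarrow> 0"
  shows "(\<lambda>n. \<nu> (K n)) \<longlonglongrightarrow> 0"
proof (rule unbounded_index_tendsto_0[OF \<nu>])
  show "K n \<le> K (Suc n)" for n by (simp add: K_Suc)
  have K1: "1 \<le> K n" for n by (induction n) (use K0 in \<open>auto simp: K_Suc\<close>)
  show "\<exists>n\<ge>m. K n \<noteq> k" for m k
  proof (rule ccontr)
    assume "\<not> (\<exists>n\<ge>m. K n \<noteq> k)"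
    then have Kk: "K n = k" if "m \<le> n" for n using that by blast
    have k: "1 \<le> k" using K1[of m] Kk[of m] by simp
    obtain \<delta> J where \<delta>: "0 < \<delta>" and over: "\<And>\<theta> x y. \<lbrakk>\<And>i. i \<le> J \<Longrightarrow> \<theta> (Suc i) = (1 - c * \<nu> k) *\<^sub>R \<theta> i + (c * \<nu> k) *\<^sub>R x i;
        norm (\<theta> 0) \<le> C; \<And>i. i < J \<Longrightarrow> dist x0 (x i) \<le> \<delta>; dist x1 (x J) \<le> \<delta>; dist x0 y \<le> \<delta>\<rbrakk>
        \<Longrightarrow> (norm (\<theta> J - y))\<^sup>2 < (norm (\<theta> (Suc J) - y))\<^sup>2"
      using constant_step_overshoots[OF step(1)[OF k] step(2)[OF k] x, of C] by metis
    obtain n where n: "m \<le> n" "\<And>i. i < J \<Longrightarrow> dist x0 (x (n + i)) \<le> \<delta>" "dist x1 (x (n + J)) \<le> \<delta>"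
      "\<And>j. j \<in> V \<Longrightarrow> dist x0 (v (n + J) j) \<le> \<delta>" using blocks[OF \<delta>, of m J] by blast
    have "(norm (\<theta> (n + J) - v (n + J) j))\<^sup>2 < (norm (\<theta> (Suc (n + J)) - v (n + J) j))\<^sup>2" if "j \<in> V" for j
      using over[of "\<lambda>i. \<theta> (n + i)" "\<lambda>i. x (n + i)" "v (n + J) j"] n that rec Kk bdd by simp
    then have "(\<Sum>j\<in>V. (norm (\<theta> (n + J) - v (n + J) j))\<^sup>2) < (\<Sum>j\<in>V. (norm (\<theta> (Suc (n + J)) - v (n + J) j))\<^sup>2)"
      by (intro sum_strict_mono V)
    then have "K (Suc (n + J)) = Suc (K (n + J))" by (simp add: K_Suc)
    then show False using Kk[of "n + J"] Kk[of "Suc (n + J)"] n(1) by simp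
  qed
qed

section \<open>Stochastic gradient descent with adaptive step sizes\<close>

text \<open>Derivatives are unique, so \<open>g\<close> is determined as a linear functional;
  testing with the difference of both sides identifies the vector.\<close>

lemma gradient_sq_dist:
  fixes \<theta> x g :: "'a::real_inner"
  assumes "((\<lambda>\<theta>'. \<kappa> * (norm (\<theta>' - x))\<^sup>2) has_derivative (\<lambda>h. g \<bullet> h)) (at \<theta>)"
  shows "g = (2 * \<kappa>) *\<^sub>R (\<theta> - x)"
proof -
  have "((\<lambda>\<theta>'. \<kappa> * ((\<theta>' - x) \<bullet> (\<theta>' - x))) has_derivative (\<lambda>h. \<kappa> * (2 * ((\<theta> - x) \<bullet> h)))) (at \<theta>)"
    by (auto intro!: derivative_eq_intros simp: inner_commute)
  then have "(\<lambda>h. g \<bullet> h) = (\<lambda>h. \<kappa> * (2 * ((\<theta> - x) \<bullet> h)))"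
    using assms unfolding power2_norm_eq_inner by (blast intro: has_derivative_unique)
  then have "g \<bullet> h = ((2 * \<kappa>) *\<^sub>R (\<theta> - x)) \<bullet> h" for h by (auto simp: fun_eq_iff)
  then have "(g - (2 * \<kappa>) *\<^sub>R (\<theta> - x)) \<bullet> h = 0" for h by (subst inner_diff_left) simp
  from this[of "g - (2 * \<kappa>) *\<^sub>R (\<theta> - x)"] show ?thesis by (simp only: inner_eq_zero_iff right_minus_eq)
qed

theorem theorem7p1:
  fixes P :: "'w measure"
    and X :: "int \<Rightarrow> int \<Rightarrow> 'w \<Rightarrow> 'a::euclidean_space"
    and \<kappa> :: real
    and l :: "'a \<Rightarrow> 'a \<Rightarrow> real"
    and gradl :: "'a \<Rightarrow> 'a \<Rightarrow> 'a"
    and M MM :: nat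
    and \<Theta> :: "nat \<Rightarrow> 'w \<Rightarrow> 'a"
    and \<gamma> :: "nat \<Rightarrow> 'w \<Rightarrow> real"
    and \<nu> :: "nat \<Rightarrow> real"
  assumes kappa_pos: "\<kappa> > 0"
    and prob: "prob_space P"
    and X_rv: "\<And>n m. X n m \<in> borel_measurable P"
    and X_indep: "prob_space.indep_vars P (\<lambda>_. borel) (\<lambda>(n, m). X n m) UNIV"
    and X_ident: "\<And>n m. distr P borel (X n m) = distr P borel (X 0 0)"
    and X_nondeg: "\<And>n m. non_degenerate P (X n m)"
    and l_def: "\<And>\<theta> x. l \<theta> x = \<kappa> * (norm (\<theta> - x))\<^sup>2"
    and gradl: "\<And>\<theta> x. ((\<lambda>\<theta>'. l \<theta>' x) has_derivative (\<lambda>h. gradl \<theta> x \<bullet> h)) (at \<theta>)"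
    and M_pos: "M \<ge> 1" and MM_pos: "MM \<ge> 1"
    and Theta_rv: "\<And>n. \<Theta> n \<in> borel_measurable P"
    and gamma_rv: "\<And>n. n \<ge> 1 \<Longrightarrow> \<gamma> n \<in> borel_measurable P"
    and Theta_rec: "\<And>n \<omega>. n \<ge> 1 \<Longrightarrow> \<omega> \<in> space P \<Longrightarrow>
        \<Theta> n \<omega> = \<Theta> (n - 1) \<omega> - (\<gamma> n \<omega> / real M) *\<^sub>R (\<Sum>m\<in>{1..int M}. gradl (\<Theta> (n - 1) \<omega>) (X (int n) m \<omega>))"
    and nu_decr: "\<And>n k. 1 \<le> n \<Longrightarrow> n < k \<Longrightarrow> \<nu> k < \<nu> n"
    and nu_limsup: "limsup (\<lambda>n. ereal (\<nu> n)) = 0"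
    and nu_sum: "filterlim (\<lambda>N. \<Sum>n\<in>{1..N}. \<nu> n) at_top sequentially"
    and gamma1: "\<And>\<omega>. \<omega> \<in> space P \<Longrightarrow> \<gamma> 1 \<omega> = \<nu> 1"
    and nu1: "\<nu> 1 < 1 / \<kappa>"
    and gamma_rec: "\<And>n \<omega>. n \<ge> 1 \<Longrightarrow> \<omega> \<in> space P \<Longrightarrow>
        \<gamma> (n + 1) \<omega> =
          (if (\<Sum>m\<in>{1..int MM}. l (\<Theta> n \<omega>) (X (int n) (- m) \<omega>))
               \<le> (\<Sum>m\<in>{1..int MM}. l (\<Theta> (n - 1) \<omega>) (X (int n) (- m) \<omega>))
           then \<gamma> n \<omega>
           else (GREATEST r. r \<in> {0<..<\<gamma> n \<omega>} \<inter> {\<nu> k | k. k \<ge> 1}))"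
    and indep_Theta0: "prob_space.indep_set P
        (sets (vimage_algebra (space P) (\<lambda>\<omega>. (\<lambda>(n, m). X n m \<omega>)) (PiM UNIV (\<lambda>_. borel))))
        (sets (vimage_algebra (space P) (\<Theta> 0) borel))"
    and moment: "(\<integral>\<^sup>+ \<omega>. ennreal ((norm (\<Theta> 0 \<omega>))\<^sup>2) + (SUP n\<in>{1::int..}. ennreal (norm (X n 0 \<omega>))) \<partial>P) < \<infinity>"
  shows "Limsup at_top (\<lambda>t::real. \<integral>\<^sup>+ \<omega>.
            ennreal ((norm (\<Theta> (LEAST n::nat. t \<le> (\<Sum>k\<in>{1..n}. \<gamma> k \<omega>)) \<omega>
                           - prob_space.expectation P (X 1 1)))\<^sup>2) \<partial>P) = 0"
proof -

  \<comment> \<open>The recursion as averaging with batch means\<close>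
  interpret prob_space P by (rule prob)
  have nu_lim: "\<nu> \<longlonglongrightarrow> 0" using nu_decr nu_limsup by (rule decreasing_limsup_0(1))
  have nu_pos: "0 < \<nu> k" if "1 \<le> k" for k using nu_decr nu_limsup that by (rule decreasing_limsup_0(2))
  have nu_anti: "\<nu> k \<le> \<nu> j" if "1 \<le> j" "j \<le> k" for j k
    using nu_decr[of j k] that by (cases "j = k") auto
  have grad: "gradl \<theta> x = (2 * \<kappa>) *\<^sub>R (\<theta> - x)" for \<theta> x
    using gradl[of x \<theta>] unfolding l_def by (rule gradient_sq_dist)
  define \<mu> where "\<mu> = distr P borel (X 0 0)"
  have ident: "distr P borel (X n m) = \<mu>" for n m using X_ident[of n m] by (simp add: \<mu>_def)
  define E where "E = expectation (X 1 1)"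
  \<comment> \<open>Shifted by one: \<open>xbar n\<close> averages the row that leads from
    \<open>\<Theta> n\<close> to \<open>\<Theta> (Suc n)\<close>.\<close>
  define xbar where "xbar n \<omega> = (1 / real M) *\<^sub>R (\<Sum>m\<in>{1..int M}. X (int n + 1) m \<omega>)" for n \<omega>
  have int_Suc: "int (Suc n) = int n + 1" for n by simp
  have Theta_Suc: "\<Theta> (Suc n) \<omega> = (1 - 2 * \<kappa> * \<gamma> (Suc n) \<omega>) *\<^sub>R \<Theta> n \<omega> + (2 * \<kappa> * \<gamma> (Suc n) \<omega>) *\<^sub>R xbar n \<omega>"
    if "\<omega> \<in> space P" for n \<omega>
  proof -
    have "(\<Sum>m\<in>{1..int M}. gradl (\<Theta> n \<omega>) (X (int n + 1) m \<omega>)) = (2 * \<kappa> * real M) *\<^sub>R (\<Theta> n \<omega> - xbar n \<omega>)"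
      using M_pos
      by (simp add: grad xbar_def sum_subtractf sum_constant_scaleR scaleR_diff_right flip: scaleR_sum_right)
    then have "(\<gamma> (Suc n) \<omega> / real M) *\<^sub>R (\<Sum>m\<in>{1..int M}. gradl (\<Theta> n \<omega>) (X (int n + 1) m \<omega>))
      = (2 * \<kappa> * \<gamma> (Suc n) \<omega>) *\<^sub>R (\<Theta> n \<omega> - xbar n \<omega>)" using M_pos by simp
    moreover have "\<Theta> (Suc n) \<omega> = \<Theta> n \<omega> - (\<gamma> (Suc n) \<omega> / real M) *\<^sub>R (\<Sum>m\<in>{1..int M}. gradl (\<Theta> n \<omega>) (X (int n + 1) m \<omega>))"
      using Theta_rec[of "Suc n" \<omega>] that unfolding int_Suc by simp
    ultimately have "\<Theta> (Suc n) \<omega> = \<Theta> n \<omega> - (2 * \<kappa> * \<gamma> (Suc n) \<omega>) *\<^sub>R (\<Theta> n \<omega> - xbar n \<omega>)" by (simp only:)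
    then show ?thesis by (simp add: algebra_simps)
  qed

  \<comment> \<open>Essential boundedness of the data and centring of the noise\<close>
  have "\<exists>c. AE \<omega> in P. norm (X (int 0 + 1) 0 \<omega>) \<le> c"
  proof (rule iid_bounded_imp_AE_bounded)
    show "indep_vars (\<lambda>_. borel) (\<lambda>n. X (int n + 1) 0) UNIV"
      using indep_vars_reindex[OF X_indep, of "\<lambda>n::nat. (int n + 1, 0)" UNIV] by (simp add: inj_on_def)
    show "distr P borel (X (int n + 1) 0) = distr P borel (X (int 0 + 1) 0)" for n by (simp add: ident)
    define G where "G \<omega> = (SUP n\<in>{1::int..}. ennreal (norm (X n 0 \<omega>)))" for \<omega>
    have "(\<lambda>\<omega>. ennreal ((norm (\<Theta> 0 \<omega>))\<^sup>2) + G \<omega>) \<in> borel_measurable P"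
      unfolding G_def using X_rv Theta_rv by measurable
    then have "AE \<omega> in P. ennreal ((norm (\<Theta> 0 \<omega>))\<^sup>2) + G \<omega> \<noteq> \<infinity>"
      using moment unfolding G_def by (intro nn_integral_PInf_AE) auto
    then show "AE \<omega> in P. \<exists>c. \<forall>n. norm (X (int n + 1) 0 \<omega>) \<le> c"
    proof eventually_elim
      case (elim \<omega>)
      then have fin: "G \<omega> < top" by (simp add: less_top)
      have "norm (X (int n + 1) 0 \<omega>) \<le> enn2real (G \<omega>)" for n
      proof -
        have "ennreal (norm (X (int n + 1) 0 \<omega>)) \<le> G \<omega>" unfolding G_def by (rule SUP_upper) simp
        from enn2real_mono[OF this fin] show ?thesis by simp
      qed
      then show ?case by blast
    qed
  qed
  then obtain c where "AE \<omega> in P. norm (X 1 0 \<omega>) \<le> c" by auto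
  \<comment> \<open>The bound is passed through the common law \<open>\<mu>\<close> from one
    variable to all rows and columns.\<close>
  then have "AE x in \<mu>. norm x \<le> c"
    unfolding ident[of 1 0, symmetric] using X_rv by (subst AE_distr_iff) auto
  then have X_le: "AE \<omega> in P. norm (X n m \<omega>) \<le> c" for n m
    unfolding ident[of n m, symmetric] using X_rv by (subst (asm) AE_distr_iff) auto
  have X_int: "integrable P (X n m)" for n m
    using X_le X_rv by (intro integrable_const_bound) auto
  have X_mean: "expectation (X n m) = E" for n m
  proof -
    have "expectation (X n m) = (\<integral>x. x \<partial>\<mu>)" for n m
      using integral_distr[OF X_rv[of n m], of "\<lambda>x. x"] by (simp add: ident)
    then show ?thesis by (simp add: E_def)
  qed
  have cardM: "card {1..int M} = M" by simp
  have xbar_rv: "xbar n \<in> borel_measurable P" for n unfolding xbar_def using X_rv by measurable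
  define \<xi> where "\<xi> n \<omega> = xbar n \<omega> - E" for n \<omega>
  define R where "R = c + norm E"
  have xi_le: "AE \<omega> in P. norm (\<xi> n \<omega>) \<le> R" for n
  proof -
    have "AE \<omega> in P. \<forall>m\<in>{1..int M}. norm (X (int n + 1) m \<omega>) \<le> c"
      using X_le by (intro AE_finite_allI) auto
    then show ?thesis
    proof eventually_elim
      case (elim \<omega>)
      have "dist 0 (xbar n \<omega>) \<le> c"
        unfolding xbar_def using dist_mean_le[of "{1..int M}" 0 "\<lambda>m. X (int n + 1) m \<omega>" c] elim M_pos
        by (simp add: cardM)
      then show ?case using norm_triangle_ineq4[of "xbar n \<omega>" E] by (simp add: \<xi>_def R_def)
    qed
  qed
  have xi_mean: "expectation (\<xi> n) = 0" for n
  proof -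
    have "integrable P (\<lambda>\<omega>. \<Sum>m\<in>{1..int M}. X (int n + 1) m \<omega>)" using X_int by simp
    then show ?thesis using M_pos
      unfolding \<xi>_def xbar_def
      by (simp add: X_int X_mean prob_space Bochner_Integration.integral_sum sum_constant_scaleR)
  qed

  \<comment> \<open>Step sizes as an index into the sequence\<close>
  define cond where "cond n \<omega> \<longleftrightarrow> (\<Sum>m\<in>{1..int MM}. (norm (\<Theta> (Suc n) \<omega> - X (int n + 1) (- m) \<omega>))\<^sup>2)
      \<le> (\<Sum>m\<in>{1..int MM}. (norm (\<Theta> n \<omega> - X (int n + 1) (- m) \<omega>))\<^sup>2)" for n \<omega>
  \<comment> \<open>\<open>K n\<close> is the index of the step size \<open>\<gamma> (Suc n)\<close> in the sequence \<open>\<nu>\<close>.\<close>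
  define K where "K = rec_nat (\<lambda>\<omega>. 1) (\<lambda>n k \<omega>. if cond n \<omega> then k \<omega> else Suc (k \<omega>))"
  have K_0: "K 0 = (\<lambda>\<omega>. 1)" and K_Suc: "K (Suc n) = (\<lambda>\<omega>. if cond n \<omega> then K n \<omega> else Suc (K n \<omega>))" for n
    by (simp_all only: K_def nat.rec)
  have K_ge: "1 \<le> K n \<omega>" for n \<omega> by (induction n) (auto simp: K_0 K_Suc)
  have K_le: "K n \<omega> \<le> Suc n" for n \<omega> by (induction n) (auto simp: K_0 K_Suc)
  have K_mono: "K i \<omega> \<le> K j \<omega>" if "i \<le> j" for i j \<omega>
    using that by (rule lift_Suc_mono_le[of "\<lambda>n. K n \<omega>", rotated]) (simp add: K_Suc)
  have greatest: "(GREATEST r. r \<in> {0<..<\<nu> k} \<inter> {\<nu> j | j. j \<ge> 1}) = \<nu> (Suc k)" if "1 \<le> k" for k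
    using nu_decr nu_pos that by (rule greatest_below)
  have gamma_eq: "\<gamma> (Suc n) \<omega> = \<nu> (K n \<omega>)" if "\<omega> \<in> space P" for n \<omega>
  proof (induction n)
    case 0
    then show ?case using gamma1[OF that] by (simp add: K_0)
  next
    case (Suc n)
    have "cond n \<omega> \<longleftrightarrow> (\<Sum>m\<in>{1..int MM}. l (\<Theta> (Suc n) \<omega>) (X (int n + 1) (- m) \<omega>))
               \<le> (\<Sum>m\<in>{1..int MM}. l (\<Theta> n \<omega>) (X (int n + 1) (- m) \<omega>))"
      using kappa_pos by (simp add: l_def cond_def flip: sum_distrib_left)
    then have "\<gamma> (Suc (Suc n)) \<omega> = (if cond n \<omega> then \<gamma> (Suc n) \<omega>
        else (GREATEST r. r \<in> {0<..<\<gamma> (Suc n) \<omega>} \<inter> {\<nu> k | k. k \<ge> 1}))"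
      using gamma_rec[of "Suc n" \<omega>] that by (simp add: int_Suc del: of_nat_Suc)
    then show ?case unfolding Suc greatest[OF K_ge] by (simp add: K_Suc)
  qed

  \<comment> \<open>Filtration and adaptedness\<close>
  define Z where "Z = case_option (\<Theta> 0) (\<lambda>(n, m). X n m)"
  have Z_indep: "indep_vars (\<lambda>_. borel) Z UNIV"
    unfolding Z_def using X_indep Theta_rv
  proof (rule indep_vars_case_option)
    have "(\<lambda>\<omega>. (\<lambda>(n, m). X n m \<omega>)) = (\<lambda>\<omega> i. (case i of (n, m) \<Rightarrow> X n m) \<omega>)" by (auto simp: fun_eq_iff)
    with indep_Theta0 show "indep_set (sets (vimage_algebra (space P) (\<lambda>\<omega> i. (case i of (n, m) \<Rightarrow> X n m) \<omega>) (PiM UNIV (\<lambda>_. borel))))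
      (sets (vimage_algebra (space P) (\<Theta> 0) borel))" by simp
  qed
  \<comment> \<open>\<open>F n\<close> knows the initial value and all rows up to \<open>n\<close>
    in every column, hence also the validation data that decide \<open>K n\<close>. Row
    \<open>n + 1\<close>, which produces \<open>\<xi> n\<close>, is left out.\<close>
  define I where "I n = insert None (Some ` ({..int n} \<times> (UNIV :: int set)))" for n
  define F where "F n = generated_by (space P) Z (I n)" for n
  have space_F: "space (F n) = space P" for n by (simp add: F_def space_generated_by)
  have F_mono: "sets (F i) \<subseteq> sets (F j)" if "i \<le> j" for i j
    unfolding F_def using that by (intro sets_generated_by_mono) (auto simp: I_def)
  have F_up: "f \<in> measurable (F j) N" if "f \<in> measurable (F i) N" "i \<le> j" for i j and f :: "'w \<Rightarrow> 'z" and N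
    using that F_mono[OF that(2)] unfolding measurable_def by (auto simp: space_F)
  have Theta0_F: "\<Theta> 0 \<in> borel_measurable (F n)" for n
    using measurable_generated_by[of None "I n" Z "space P"] by (simp add: F_def I_def Z_def)
  have X_F: "X i m \<in> borel_measurable (F n)" if "i \<le> int n" for i m n
    using measurable_generated_by[of "Some (i, m)" "I n" Z "space P"] that by (simp add: F_def I_def Z_def)
  have adapted: "\<Theta> n \<in> borel_measurable (F n) \<and> K n \<in> measurable (F n) (count_space UNIV)" for n
  proof (induction n)
    case 0
    then show ?case using Theta0_F by (simp add: K_0)
  next
    case (Suc n)
    have [measurable]: "\<Theta> n \<in> borel_measurable (F (Suc n))" "K n \<in> measurable (F (Suc n)) (count_space UNIV)"
      using Suc F_up[of _ n _ "Suc n"] by auto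
    have [measurable]: "X (int n + 1) m \<in> borel_measurable (F (Suc n))" for m by (rule X_F) simp
    have "(\<lambda>\<omega>. (1 - 2 * \<kappa> * \<nu> (K n \<omega>)) *\<^sub>R \<Theta> n \<omega> + (2 * \<kappa> * \<nu> (K n \<omega>)) *\<^sub>R xbar n \<omega>) \<in> borel_measurable (F (Suc n))"
      unfolding xbar_def by measurable
    then have [measurable]: "\<Theta> (Suc n) \<in> borel_measurable (F (Suc n))"
      by (rule measurable_cong[THEN iffD1, rotated]) (simp add: space_F Theta_Suc gamma_eq)
    have "K (Suc n) \<in> measurable (F (Suc n)) (count_space UNIV)"
      unfolding K_Suc cond_def by measurable
    then show ?case by simp
  qed

  \<comment> \<open>Errors and rates, and the convergence of the rates to 0\<close>
  define e where "e n \<omega> = \<Theta> n \<omega> - E" for n \<omega>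
  define a where "a n \<omega> = 2 * \<kappa> * \<nu> (K n \<omega>)" for n \<omega>
  \<comment> \<open>The rate if every earlier validation had decreased the step size; it is a lower
    bound because \<open>K n \<omega> \<le> Suc n\<close> and \<open>\<nu>\<close>
    decreases.\<close>
  define b where "b n = 2 * \<kappa> * \<nu> (Suc n)" for n
  define \<alpha> where "\<alpha> = 2 * \<kappa> * \<nu> 1"
  have \<alpha>: "\<alpha> < 2" using nu1 kappa_pos by (simp add: \<alpha>_def field_simps)
  have a_pos: "0 < a n \<omega>" for n \<omega> using nu_pos[OF K_ge] kappa_pos by (simp add: a_def)
  have a_le: "a n \<omega> \<le> \<alpha>" for n \<omega> using nu_anti[OF _ K_ge[of n \<omega>]] kappa_pos by (simp add: a_def \<alpha>_def)
  have e_rec: "e (Suc n) \<omega> = (1 - a n \<omega>) *\<^sub>R e n \<omega> + a n \<omega> *\<^sub>R \<xi> n \<omega>" if "\<omega> \<in> space P" for n \<omega>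
    using Theta_Suc[OF that, of n] by (simp add: e_def \<xi>_def a_def gamma_eq[OF that] algebra_simps)

  have a_lim: "AE \<omega> in P. (\<lambda>n. a n \<omega>) \<longlonglongrightarrow> 0"
  proof -
    obtain x0 x1 where x: "x0 \<noteq> x1" "x0 \<in> measure_support \<mu>" "x1 \<in> measure_support \<mu>"
      using two_points_in_support[OF X_nondeg[of 0 0]] by (metis \<mu>_def)
    \<comment> \<open>The radii are restricted to the countable family
      \<open>inverse (Suc k)\<close>, so that one null set serves all \<open>J\<close> and all
      radii.\<close>
    have "AE \<omega> in P. \<forall>J k. \<forall>n0. \<exists>n\<ge>n0. (\<forall>i<J. \<forall>m\<in>{1..int M}. dist x0 (X (int (n + i) + 1) m \<omega>) \<le> inverse (real (Suc k)))
      \<and> (\<forall>m\<in>{1..int M}. dist x1 (X (int (n + J) + 1) m \<omega>) \<le> inverse (real (Suc k)))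
      \<and> (\<forall>m\<in>{1..int MM}. dist x0 (X (int (n + J) + 1) (- m) \<omega>) \<le> inverse (real (Suc k)))"
      by (rule AE_all_countable[THEN iffD2], rule allI, rule AE_all_countable[THEN iffD2], rule allI,
          rule blocks_near_two_points[OF X_indep ident x(2,3)]) simp
    moreover have "AE \<omega> in P. \<forall>n. norm (\<xi> n \<omega>) \<le> R" using xi_le by (simp add: AE_all_countable)
    ultimately show ?thesis using AE_space
    proof eventually_elim
      case (elim \<omega>)
      have "(\<lambda>n. \<nu> (K n \<omega>)) \<longlonglongrightarrow> 0"
      \<comment> \<open>The path is fixed here, so the bound \<open>C\<close> may depend on it
        through \<open>e 0 \<omega>\<close>.\<close>
      proof (rule adaptive_steps_tendsto_0[where \<theta>="\<lambda>n. \<Theta> n \<omega>" and x="\<lambda>n. xbar n \<omega>" and c="2 * \<kappa>"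
            and v="\<lambda>n m. X (int n + 1) (- m) \<omega>" and V="{1..int MM}" and ?x0.0=x0 and ?x1.0=x1
            and C="max (norm (e 0 \<omega>)) (2 * R / (2 - \<alpha>)) + norm E"])
        show "\<Theta> (Suc n) \<omega> = (1 - 2 * \<kappa> * \<nu> (K n \<omega>)) *\<^sub>R \<Theta> n \<omega> + (2 * \<kappa> * \<nu> (K n \<omega>)) *\<^sub>R xbar n \<omega>" for n
          using Theta_Suc[OF elim(3)] gamma_eq[OF elim(3)] by simp
        show "norm (\<Theta> n \<omega>) \<le> max (norm (e 0 \<omega>)) (2 * R / (2 - \<alpha>)) + norm E" for n
        proof -
          have "norm (e n \<omega>) \<le> max (norm (e 0 \<omega>)) (2 * R / (2 - \<alpha>))"
            using elim(2) by (intro averaging_bounded[where a="\<lambda>n. a n \<omega>" and \<xi>="\<lambda>n. \<xi> n \<omega>"] e_rec[OF elim(3)] less_imp_le[OF a_pos] a_le \<alpha>) auto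
          then show ?thesis using norm_triangle_ineq[of "e n \<omega>" E] by (simp add: e_def)
        qed
        show "0 < 2 * \<kappa> * \<nu> k" if "1 \<le> k" for k using nu_pos[OF that] kappa_pos by simp
        show "2 * \<kappa> * \<nu> k < 2" if "1 \<le> k" for k
        proof -
          have "2 * \<kappa> * \<nu> k \<le> \<alpha>" unfolding \<alpha>_def using nu_anti[of 1 k] that kappa_pos by simp
          then show ?thesis using \<alpha> by simp
        qed
        show "finite {1..int MM}" "{1..int MM} \<noteq> {}" using MM_pos by auto
        show "1 \<le> K 0 \<omega>" by (rule K_ge)
        show "K (Suc n) \<omega> = (if (\<Sum>m\<in>{1..int MM}. (norm (\<Theta> (Suc n) \<omega> - X (int n + 1) (- m) \<omega>))\<^sup>2)
          \<le> (\<Sum>m\<in>{1..int MM}. (norm (\<Theta> n \<omega> - X (int n + 1) (- m) \<omega>))\<^sup>2) then K n \<omega> else Suc (K n \<omega>))" for n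
          by (simp add: K_Suc cond_def)
        show "\<nu> \<longlonglongrightarrow> 0" "x0 \<noteq> x1" by (rule nu_lim, rule x)
        fix \<delta> :: real and J n0 assume "0 < \<delta>"
        then obtain k where k: "inverse (real (Suc k)) < \<delta>" using reals_Archimedean by blast
        obtain n where n: "n0 \<le> n" "\<And>i m. i < J \<Longrightarrow> m \<in> {1..int M} \<Longrightarrow> dist x0 (X (int (n + i) + 1) m \<omega>) \<le> inverse (real (Suc k))"
          "\<And>m. m \<in> {1..int M} \<Longrightarrow> dist x1 (X (int (n + J) + 1) m \<omega>) \<le> inverse (real (Suc k))"
          "\<And>m. m \<in> {1..int MM} \<Longrightarrow> dist x0 (X (int (n + J) + 1) (- m) \<omega>) \<le> inverse (real (Suc k))"
          using elim(1) by metis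
        have near: "dist z (xbar j \<omega>) \<le> inverse (real (Suc k))"
          if "\<And>m. m \<in> {1..int M} \<Longrightarrow> dist z (X (int j + 1) m \<omega>) \<le> inverse (real (Suc k))" for z j
          using dist_mean_le[of "{1..int M}" z "\<lambda>m. X (int j + 1) m \<omega>", OF _ _ that] M_pos by (simp add: xbar_def)
        show "\<exists>n\<ge>n0. (\<forall>i<J. dist x0 (xbar (n + i) \<omega>) \<le> \<delta>) \<and> dist x1 (xbar (n + J) \<omega>) \<le> \<delta>
          \<and> (\<forall>m\<in>{1..int MM}. dist x0 (X (int (n + J) + 1) (- m) \<omega>) \<le> \<delta>)"
        proof (intro exI[of _ n] conjI allI impI ballI)
          show "dist x0 (xbar (n + i) \<omega>) \<le> \<delta>" if "i < J" for i
            using near[of x0 "n + i", OF n(2)[OF that]] k by simp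
          show "dist x1 (xbar (n + J) \<omega>) \<le> \<delta>" using near[of x1 "n + J", OF n(3)] k by simp
          show "dist x0 (X (int (n + J) + 1) (- m) \<omega>) \<le> \<delta>" if "m \<in> {1..int MM}" for m
            using n(4)[OF that] k by simp
        qed (rule n)
      qed
      then show ?case unfolding a_def by (rule tendsto_mult_right_zero)
    qed
  qed

  \<comment> \<open>The error as an averaging process, and the change of time scale\<close>
  interpret averaging_process P F e \<xi> a b \<alpha> R
  proof
    show "space (F n) = space P" for n by (rule space_F)
    show "sets (F i) \<subseteq> sets (F j)" if "i \<le> j" for i j using that by (rule F_mono)
    have [measurable]: "\<Theta> n \<in> borel_measurable (F n)" "K n \<in> measurable (F n) (count_space UNIV)" for n
      using adapted by auto
    show "e n \<in> borel_measurable (F n)" for n unfolding e_def by measurable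
    show "a n \<in> borel_measurable (F n)" for n unfolding a_def by measurable
    show "\<xi> n \<in> borel_measurable P" for n unfolding \<xi>_def using xbar_rv by simp
    show "indep_set (sets (F n)) (sigma_sets (space P) {\<xi> n -` A \<inter> space P |A. A \<in> sets borel})" for n
      unfolding F_def
    proof (rule indep_set_generated_by[OF Z_indep, where J="Some ` ({int n + 1} \<times> UNIV)"])
      show "I n \<inter> Some ` ({int n + 1} \<times> UNIV) = {}" by (auto simp: I_def)
      have [measurable]: "X (int n + 1) m \<in> borel_measurable (generated_by (space P) Z (Some ` ({int n + 1} \<times> UNIV)))" for m
        using measurable_generated_by[of "Some (int n + 1, m)" "Some ` ({int n + 1} \<times> UNIV)" Z "space P"] by (simp add: Z_def)
      show "\<xi> n \<in> borel_measurable (generated_by (space P) Z (Some ` ({int n + 1} \<times> UNIV)))"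
        unfolding \<xi>_def xbar_def by measurable
    qed
    show "0 < b n" for n using nu_pos[of "Suc n"] kappa_pos by (simp add: b_def)
    show "b n \<le> a n \<omega>" for n \<omega> using nu_anti[OF K_ge K_le] kappa_pos by (simp add: a_def b_def)
    show "filterlim (\<lambda>n. \<Sum>k<n. b k) at_top sequentially"
    proof -
      have "(\<Sum>k<n. b k) = 2 * \<kappa> * (\<Sum>k\<in>{1..n}. \<nu> k)" for n
        by (induction n) (simp_all add: b_def algebra_simps)
      then show ?thesis
        using filterlim_tendsto_pos_mult_at_top[OF tendsto_const _ nu_sum, of "2 * \<kappa>"] kappa_pos by simp
    qed
    show "a j \<omega> \<le> a i \<omega>" if "i \<le> j" for i j \<omega>
      using nu_anti[OF K_ge K_mono[OF that]] kappa_pos by (simp add: a_def)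
    show "integrable P (\<lambda>\<omega>. (norm (e 0 \<omega>))\<^sup>2)"
    proof (rule Bochner_Integration.integrable_bound[where f="\<lambda>\<omega>. 2 * (norm (\<Theta> 0 \<omega>))\<^sup>2 + 2 * (norm E)\<^sup>2"])
      have "(\<integral>\<^sup>+ \<omega>. ennreal ((norm (\<Theta> 0 \<omega>))\<^sup>2) \<partial>P)
        \<le> (\<integral>\<^sup>+ \<omega>. ennreal ((norm (\<Theta> 0 \<omega>))\<^sup>2) + (SUP n\<in>{1::int..}. ennreal (norm (X n 0 \<omega>))) \<partial>P)"
        by (intro nn_integral_mono) simp
      also note moment
      finally have "integrable P (\<lambda>\<omega>. (norm (\<Theta> 0 \<omega>))\<^sup>2)"
        using Theta_rv by (intro integrableI_nonneg) auto
      then show "integrable P (\<lambda>\<omega>. 2 * (norm (\<Theta> 0 \<omega>))\<^sup>2 + 2 * (norm E)\<^sup>2)" by simp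
      show "(\<lambda>\<omega>. (norm (e 0 \<omega>))\<^sup>2) \<in> borel_measurable P" unfolding e_def using Theta_rv by simp
      have "(norm (x - y))\<^sup>2 \<le> 2 * (norm x)\<^sup>2 + 2 * (norm y)\<^sup>2" for x y :: 'a
      proof -
        have "(norm (x - y))\<^sup>2 \<le> (norm x + norm y)\<^sup>2" by (intro power_mono norm_triangle_ineq4) simp
        also have "\<dots> \<le> 2 * (norm x)\<^sup>2 + 2 * (norm y)\<^sup>2" using zero_le_power2[of "norm x - norm y"]
          by (simp add: power2_eq_square algebra_simps)
        finally show ?thesis .
      qed
      then show "AE \<omega> in P. norm ((norm (e 0 \<omega>))\<^sup>2) \<le> norm (2 * (norm (\<Theta> 0 \<omega>))\<^sup>2 + 2 * (norm E)\<^sup>2)"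
        by (simp add: e_def)
    qed
  qed (use xi_le xi_mean e_rec a_le \<alpha> a_lim in auto)

  \<comment> \<open>Rates are \<open>2 * \<kappa>\<close> times step sizes, so the step sizes
    accumulate to \<open>t\<close> exactly when the rates accumulate to
    \<open>2 * \<kappa> * t\<close>.\<close>
  have N_eq: "N (2 * \<kappa> * t) \<omega> = (LEAST n. t \<le> (\<Sum>k\<in>{1..n}. \<gamma> k \<omega>))" if "\<omega> \<in> space P" for t \<omega>
  proof -
    have "(\<Sum>k<n. a k \<omega>) = 2 * \<kappa> * (\<Sum>k\<in>{1..n}. \<gamma> k \<omega>)" for n
      by (induction n) (simp_all add: a_def gamma_eq[OF that] algebra_simps)
    then show ?thesis unfolding N_def S_def using kappa_pos by simp
  qed
  have "filterlim (\<lambda>t. 2 * \<kappa> * t) at_top at_top"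
    using kappa_pos by (intro filterlim_tendsto_pos_mult_at_top[OF tendsto_const] filterlim_ident) auto
  from filterlim_compose[OF energy_at_N_tendsto_0 this]
  have "((\<lambda>t. \<integral>\<^sup>+ \<omega>. ennreal ((norm (\<Theta> (LEAST n. t \<le> (\<Sum>k\<in>{1..n}. \<gamma> k \<omega>)) \<omega> - E))\<^sup>2) \<partial>P) \<longlongrightarrow> 0) at_top"
    by (rule Lim_transform_eventually) (auto intro!: always_eventually nn_integral_cong simp: N_eq e_def)
  then show ?thesis unfolding E_def by (intro lim_imp_Limsup) auto
qed

end
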